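(* Assume that $\Omega$ is a convex polygon in $\mathbb{R}^2$, and let $u$ be the unique function in $W^{1,2}_0(\Omega)$ with $\Delta u=-1$ in $\Omega$. Then for every $\beta\in(0,1)$, $$\int_\Omega u(x)^{-\beta}\,dx\le C(\mathrm{ecc}(\Omega),\beta)\Bigl(\frac{\mathrm{diam}(\Omega)}{R_\Omega}\Bigr)^{m\beta+2}|\Omega|^{1-\beta},$$ where $m>0$ depends only on $\mathrm{ecc}(\Omega)$ and $C(\mathrm{ecc}(\Omega),\beta)$ is a finite constant depending only on $\mathrm{ecc}(\Omega)$ and $\beta$.
   Context: Convex polygons are regarded as open bounded sets. The eccentricity of an open, bounded convex set $\Omega\subseteq\mathbb{R}^n$ is $$\mathrm{ecc}(\Omega):=\frac{\inf\{R_1>0:\ \exists\,x\in\mathbb{R}^n\text{ with }\Omega\subseteq B(x,R_1)\}}{\sup\{R_2>0:\ \exists\,x\in\mathbb{R}^n\text{ with }B(x,R_2)\subseteq\Omega\}}.$$ For a convex polygon $\Omega\subseteq\mathbb{R}^2$, a number $R>0$ is called an admissible radius for $\Omega$ if for each side of $\Omega$ there exists a ball of radius $R$ contained in $\Omega$ which is tangent to that side. The maximal admissible radius is $R_\Omega:=\sup\{R>0:\ R\text{ is an admissible radius for }\Omega\}$. $|\Omega|$ denotes Lebesgue measure. *)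

theory Defs
  imports "HOL-Analysis.Analysis"
begin

section \<open>Convex polygons, eccentricity and maximal admissible radius\<close>

definition ecc :: "'a::euclidean_space set \<Rightarrow> real" where
  "ecc \<Omega> = Inf {R1. R1 > 0 \<and> (\<exists>x. \<Omega> \<subseteq> ball x R1)} / Sup {R2. R2 > 0 \<and> (\<exists>x. ball x R2 \<subseteq> \<Omega>)}"

text \<open>Polygons are open: the interior of a full-dimensional convex polytope in the plane.\<close>

definition convex_polygon :: "(real^2) set \<Rightarrow> bool" where
  "convex_polygon \<Omega> \<longleftrightarrow> \<Omega> \<noteq> {} \<and> (\<exists>P. polytope P \<and> \<Omega> = interior P)"

definition sides :: "(real^2) set \<Rightarrow> (real^2) set set" where
  "sides \<Omega> = {F. F facet_of closure \<Omega>}"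

text \<open>In the plane, the line through a side is tangent to a disc iff the two have exactly one
  point in common; the point of tangency is required to lie on the side itself.\<close>

definition tangent_to_side :: "real^2 \<Rightarrow> real \<Rightarrow> (real^2) set \<Rightarrow> bool" where
  "tangent_to_side x R F \<longleftrightarrow> (\<exists>p\<in>F. cball x R \<inter> affine hull F = {p})"

definition admissible_radius :: "(real^2) set \<Rightarrow> real \<Rightarrow> bool" where
  "admissible_radius \<Omega> R \<longleftrightarrow>
     R > 0 \<and> (\<forall>F\<in>sides \<Omega>. \<exists>x. ball x R \<subseteq> \<Omega> \<and> tangent_to_side x R F)"

definition max_admissible_radius :: "(real^2) set \<Rightarrow> real" where
  "max_admissible_radius \<Omega> = Sup {R. admissible_radius \<Omega> R}"


section \<open>Test functions, Sobolev spaces and weak solutions\<close>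

definition partial :: "'a::euclidean_space \<Rightarrow> ('a \<Rightarrow> real) \<Rightarrow> 'a \<Rightarrow> real" where
  "partial i f x = frechet_derivative f (at x) i"

definition grad :: "('a::euclidean_space \<Rightarrow> real) \<Rightarrow> 'a \<Rightarrow> 'a" where
  "grad f x = (\<Sum>i\<in>Basis. partial i f x *\<^sub>R i)"

definition laplacian :: "('a::euclidean_space \<Rightarrow> real) \<Rightarrow> 'a \<Rightarrow> real" where
  "laplacian f x = (\<Sum>i\<in>Basis. partial i (partial i f) x)"

primrec k_times_cont_diff :: "nat \<Rightarrow> ('a::euclidean_space \<Rightarrow> real) \<Rightarrow> bool" where
  "k_times_cont_diff 0 f \<longleftrightarrow> continuous_on UNIV f"
| "k_times_cont_diff (Suc k) f \<longleftrightarrow>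
     (\<forall>x. f differentiable (at x)) \<and> (\<forall>i\<in>Basis. k_times_cont_diff k (partial i f))"

definition test_function :: "'a::euclidean_space set \<Rightarrow> ('a \<Rightarrow> real) \<Rightarrow> bool" where
  "test_function \<Omega> \<phi> \<longleftrightarrow>
     (\<forall>k. k_times_cont_diff k \<phi>) \<and>
     compact (closure (support_on UNIV \<phi>)) \<and> closure (support_on UNIV \<phi>) \<subseteq> \<Omega>"

definition L2 :: "'a::euclidean_space set \<Rightarrow> ('a \<Rightarrow> 'b::euclidean_space) \<Rightarrow> bool" where
  "L2 \<Omega> f \<longleftrightarrow> f \<in> borel_measurable (lebesgue_on \<Omega>) \<and>
     integrable (lebesgue_on \<Omega>) (\<lambda>x. (norm (f x))\<^sup>2)"

definition weak_gradient :: "'a::euclidean_space set \<Rightarrow> ('a \<Rightarrow> real) \<Rightarrow> ('a \<Rightarrow> 'a) \<Rightarrow> bool" where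
  "weak_gradient \<Omega> u g \<longleftrightarrow>
     (\<forall>\<phi>. test_function \<Omega> \<phi> \<longrightarrow> (\<forall>i\<in>Basis.
        (LINT x|lebesgue_on \<Omega>. u x * partial i \<phi> x) = - (LINT x|lebesgue_on \<Omega>. (g x \<bullet> i) * \<phi> x)))"

text \<open>The closure of the test functions in the norm of \<open>W\<^sup>1\<^sup>,\<^sup>2(\<Omega>)\<close>. Membership depends only on the
  values of \<open>u\<close> almost everywhere in \<open>\<Omega>\<close>.\<close>

definition W012 :: "'a::euclidean_space set \<Rightarrow> ('a \<Rightarrow> real) set" where
  "W012 \<Omega> = {u. L2 \<Omega> u \<and> (\<exists>g. L2 \<Omega> g \<and> weak_gradient \<Omega> u g \<and>
     (\<exists>\<phi>. (\<forall>k::nat. test_function \<Omega> (\<phi> k)) \<and>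
        (\<lambda>k. LINT x|lebesgue_on \<Omega>. (\<phi> k x - u x)\<^sup>2 + (norm (grad (\<phi> k) x - g x))\<^sup>2)
          \<longlonglongrightarrow> 0))}"

text \<open>\<open>\<Delta>u = f\<close> in \<open>\<Omega>\<close> in the sense of distributions.\<close>

definition weak_laplacian :: "'a::euclidean_space set \<Rightarrow> ('a \<Rightarrow> real) \<Rightarrow> ('a \<Rightarrow> real) \<Rightarrow> bool" where
  "weak_laplacian \<Omega> u f \<longleftrightarrow>
     (\<forall>\<phi>. test_function \<Omega> \<phi> \<longrightarrow>
        (LINT x|lebesgue_on \<Omega>. u x * laplacian \<phi> x) = (LINT x|lebesgue_on \<Omega>. f x * \<phi> x))"

text \<open>The negative power \<open>t\<^sup>-\<^sup>\<beta>\<close> with value \<open>\<infinity>\<close> for \<open>t \<le> 0\<close>; in particular a finite integral of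
  \<open>u\<^sup>-\<^sup>\<beta>\<close> entails \<open>u > 0\<close> almost everywhere, unlike with the total function \<open>powr\<close>.\<close>

definition neg_power :: "real \<Rightarrow> real \<Rightarrow> ennreal" where
  "neg_power t \<beta> = (if t > 0 then ennreal (t powr - \<beta>) else \<infinity>)"

end

theory Submission
  imports Defs
begin

text \<open>
  If a disc \<open>B(c, r)\<close> lies in \<open>\<Omega>\<close>, comparison with its torsion function gives
  \<open>u(x) \<ge> (r\<^sup>2 - |x - c|\<^sup>2) / 4\<close>. Let \<open>y\<close> be a boundary point nearest to \<open>x\<close>, on a side \<open>F\<close> of length
  \<open>l\<close>, let \<open>h = |x - y|\<close>, and let \<open>s\<close> be the position of \<open>y\<close> along \<open>F\<close>. By convexity the disc of
  admissible radius \<open>R\<close> tangent to \<open>F\<close> can be slid to \<open>y\<close> after shrinking it by the factor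
  \<open>min(s, l - s) / l\<close>, and \<open>B(x, h)\<close> also lies in \<open>\<Omega>\<close>. The better of the two bounds is at least
  \<open>h R min(s, l - s) / (4 l)\<close>, whose power \<open>-\<beta>\<close> integrates over the strip of height
  \<open>D = diam \<Omega>\<close> along \<open>F\<close> to at most a multiple of \<open>R\<^sup>-\<^sup>\<beta> D\<^sup>1\<^sup>-\<^sup>\<beta> l\<close>. The side lengths sum to \<open>O(D)\<close>
  because the outer strips of height \<open>D\<close> along the sides are disjoint and lie in a disc of radius
  \<open>2 D\<close>. Finally \<open>D\<^sup>2\<close> is at most a multiple of \<open>ecc(\<Omega>)\<^sup>2 |\<Omega>|\<close>, and \<open>m = 1\<close> suffices.
\<close>

section \<open>Smooth functions\<close>

text \<open>The test function is built instead from an approximant \<phi> of \<open>u\<close>, which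
  leaves an error equal to the squared L2 distance of the gradients. A barrier with laplacian at
  least -\<theta>, where \<theta> < 1, leaves a factor 1 - \<theta> in front of the excess, by which
  this vanishing error can be divided; \<theta> tends to 1 only afterwards. Near a side the lower
  bound is deliberately a product of a function of h and a function of s. In orthonormal coordinates
  its negative power then integrates as a product of two one-dimensional integrals, both convergent
  because \<beta> < 1. The resulting estimate is linear in l, so it can be summed without any bound
  on the number of sides. Since attainment of the supremum is not established, a radius above half
  of it is used, at the cost of a factor 2^\<beta>.\<close>

lemma partial_eqI: "(f has_derivative D) (at x) \<Longrightarrow> partial i f x = D i"
  unfolding partial_def using frechet_derivative_at by metis

lemma k_times_cont_diff_SucD: "k_times_cont_diff (Suc k) f \<Longrightarrow> k_times_cont_diff k f"
proof (induction k arbitrary: f)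
  case 0
  then show ?case
    by (auto intro!: continuous_at_imp_continuous_on differentiable_imp_continuous_within)
next
  case (Suc k)
  then show ?case by (metis k_times_cont_diff.simps(2))
qed

lemma k_times_cont_diff_const: "k_times_cont_diff k (\<lambda>_. c)"
proof (induction k arbitrary: c)
  case (Suc k)
  have "partial i (\<lambda>_::'a. c) = (\<lambda>_. 0)" for i
    by (rule ext, subst partial_eqI[OF has_derivative_const], rule refl)
  with Suc show ?case by simp
qed simp

lemma k_times_cont_diff_inner: "k_times_cont_diff k (\<lambda>x. x \<bullet> a)"
proof (cases k)
  case (Suc k)
  have "partial i (\<lambda>x::'a. x \<bullet> a) = (\<lambda>_. i \<bullet> a)" for i
    by (rule ext, rule partial_eqI) (auto intro!: derivative_eq_intros)
  moreover have "(\<lambda>x::'a. x \<bullet> a) differentiable (at x)" for x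
    by simp
  ultimately show ?thesis using Suc by (simp add: k_times_cont_diff_const)
qed (auto intro: continuous_intros)

lemma partial_add:
  assumes "f differentiable (at x)" "g differentiable (at x)"
  shows "partial i (\<lambda>x. f x + g x) x = partial i f x + partial i g x"
  using has_derivative_add[OF assms[unfolded frechet_derivative_works]]
  by (subst partial_eqI, assumption) (simp add: partial_def)

lemma partial_mult:
  assumes "f differentiable (at x)" "g differentiable (at x)"
  shows "partial i (\<lambda>x. f x * g x) x = f x * partial i g x + partial i f x * g x"
  using has_derivative_mult[OF assms[unfolded frechet_derivative_works]]
  by (subst partial_eqI, assumption) (simp add: partial_def)

lemma partial_compose:
  assumes "f differentiable (at x)" "(\<Phi> has_real_derivative d) (at (f x))"
  shows "partial i (\<lambda>x. \<Phi> (f x)) x = d * partial i f x"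
    and "(\<lambda>x. \<Phi> (f x)) differentiable (at x)"
proof -
  have "((\<lambda>x. \<Phi> (f x)) has_derivative (\<lambda>h. d * frechet_derivative f (at x) h)) (at x)"
    using has_derivative_compose[OF assms(1)[unfolded frechet_derivative_works]
        assms(2)[unfolded has_field_derivative_def]] by (simp add: mult.commute)
  then show "partial i (\<lambda>x. \<Phi> (f x)) x = d * partial i f x"
    "(\<lambda>x. \<Phi> (f x)) differentiable (at x)"
    by (auto simp: partial_def differentiable_def dest: partial_eqI)
qed

lemma k_times_cont_diff_add:
  "k_times_cont_diff k f \<Longrightarrow> k_times_cont_diff k g \<Longrightarrow> k_times_cont_diff k (\<lambda>x. f x + g x)"
proof (induction k arbitrary: f g)
  case (Suc k)
  then have "partial i (\<lambda>x. f x + g x) = (\<lambda>x. partial i f x + partial i g x)" for i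
    by (intro ext partial_add) auto
  with Suc show ?case by simp
qed (auto intro: continuous_intros)

lemma k_times_cont_diff_mult:
  "k_times_cont_diff k f \<Longrightarrow> k_times_cont_diff k g \<Longrightarrow> k_times_cont_diff k (\<lambda>x. f x * g x)"
proof (induction k arbitrary: f g)
  case (Suc k)
  then have "partial i (\<lambda>x. f x * g x) = (\<lambda>x. f x * partial i g x + partial i f x * g x)" for i
    by (intro ext partial_mult) auto
  moreover have "k_times_cont_diff k f" "k_times_cont_diff k g"
    using Suc.prems by (blast intro: k_times_cont_diff_SucD)+
  ultimately show ?case using Suc.prems
    by (simp add: k_times_cont_diff_add Suc.IH)
qed (auto intro: continuous_intros)

text \<open>Closed under differentiation and flat at \<open>0\<close>: \<open>flat_poly 1\<close> is the standard smooth function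
  vanishing exactly on the negative half-line.\<close>

definition flat_poly :: "real poly \<Rightarrow> real \<Rightarrow> real" where
  "flat_poly p t = (if t > 0 then poly p (1 / t) * exp (- 1 / t) else 0)"

lemma poly_over_exp_tendsto_0: "((\<lambda>s. poly p s * exp (- s)) \<longlongrightarrow> (0::real)) at_top"
proof -
  have "((\<lambda>s. \<Sum>i\<le>degree p. coeff p i * (s ^ i / exp s)) \<longlongrightarrow> (\<Sum>i\<le>degree p. coeff p i * 0)) at_top"
    by (intro tendsto_sum tendsto_mult tendsto_const tendsto_power_div_exp_0)
  moreover have "poly p s * exp (- s) = (\<Sum>i\<le>degree p. coeff p i * (s ^ i / exp s))" for s
    by (simp only: poly_altdef exp_minus sum_distrib_right mult.assoc divide_inverse)
  ultimately show ?thesis by simp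
qed

lemma flat_poly_tendsto_0: "(flat_poly p \<longlongrightarrow> 0) (at 0)"
proof -
  have "((\<lambda>t. poly p (inverse t) * exp (- inverse t)) \<longlongrightarrow> 0) (at_right 0)"
    using filterlim_compose[OF poly_over_exp_tendsto_0 filterlim_inverse_at_top_right] .
  moreover have "\<forall>\<^sub>F t in at_right 0. poly p (inverse t) * exp (- inverse t) = flat_poly p t"
    by (rule eventually_mono[OF eventually_at_right_less]) (simp add: flat_poly_def divide_inverse)
  ultimately have "(flat_poly p \<longlongrightarrow> 0) (at_right 0)"
    by (rule Lim_transform_eventually)
  moreover have "\<forall>\<^sub>F t in at_left (0::real). 0 = flat_poly p t"
    by (auto simp: flat_poly_def eventually_at_filter)
  then have "(flat_poly p \<longlongrightarrow> 0) (at_left 0)"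
    by (rule Lim_transform_eventually[OF tendsto_const])
  ultimately show ?thesis by (simp add: filterlim_at_split)
qed

text \<open>In the variable s = 1/t, differentiation in t is -s^2 d/ds, and it sends p(s) exp(-s) to
  s^2 (p - p')(s) exp(-s). The list \<open>[:0, 0, 1:]\<close> is the polynomial s^2.\<close>

lemma flat_poly_deriv:
  "(flat_poly p has_real_derivative flat_poly ([:0, 0, 1:] * (p - pderiv p)) t) (at t)"
proof -
  consider "t > 0" | "t < 0" | "t = 0" by linarith
  then show ?thesis
  proof cases
    case 1
    have inv: "((\<lambda>t. c / t) has_real_derivative - c * (1 / t)\<^sup>2) (at t)" for c
      using 1 by (auto intro!: derivative_eq_intros simp: power2_eq_square)
    have "((\<lambda>t. poly p (1 / t) * exp (- 1 / t)) has_real_derivative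
        poly p (1 / t) * (exp (- 1 / t) * (1 / t)\<^sup>2)
        + (poly (pderiv p) (1 / t) * - (1 / t)\<^sup>2) * exp (- 1 / t)) (at t)"
      using DERIV_mult[OF DERIV_chain2[OF poly_DERIV inv[of 1]] DERIV_chain2[OF DERIV_exp inv[of "- 1"]]]
      by (simp only: mult_ac add.commute mult_minus_left mult_minus_right minus_minus mult_1)
    moreover have "poly p s * (e * s\<^sup>2) + (poly (pderiv p) s * - s\<^sup>2) * e
        = poly ([:0, 0, 1:] * (p - pderiv p)) s * e" for s e :: real
      unfolding poly_mult poly_diff by (simp add: power2_eq_square algebra_simps)
    ultimately have "((\<lambda>t. poly p (1 / t) * exp (- 1 / t)) has_real_derivative
        flat_poly ([:0, 0, 1:] * (p - pderiv p)) t) (at t)"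
      using 1 by (simp only: flat_poly_def if_True)
    then show ?thesis
      by (rule DERIV_cong_ev[OF refl _ refl, THEN iffD1, rotated])
        (rule eventually_mono[OF eventually_nhds_in_open[of "{0<..}"]], use 1 in \<open>auto simp: flat_poly_def\<close>)
  next
    case 2
    have "((\<lambda>t. 0) has_real_derivative flat_poly ([:0, 0, 1:] * (p - pderiv p)) t) (at t)"
      using 2 unfolding flat_poly_def by (auto simp del: poly_mult)
    then show ?thesis
      by (rule DERIV_cong_ev[OF refl _ refl, THEN iffD1, rotated])
        (rule eventually_mono[OF eventually_nhds_in_open[of "{..<0}"]], use 2 in \<open>auto simp: flat_poly_def\<close>)
  next
    case 3
    \<comment> \<open>The difference quotient at 0 belongs to the same family: dividing by h
      multiplies the polynomial in 1/h by its variable. Flatness at 0 then makes the derivative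
      vanish.\<close>
    have "(\<lambda>h. (flat_poly p h - flat_poly p 0) / (h - 0)) = flat_poly ([:0, 1:] * p)"
      by (auto simp: flat_poly_def fun_eq_iff)
    then have "(flat_poly p has_real_derivative 0) (at 0)"
      using flat_poly_tendsto_0[of "[:0, 1:] * p"] unfolding has_field_derivative_iff by (simp only:)
    moreover have "flat_poly ([:0, 0, 1:] * (p - pderiv p)) 0 = 0"
      unfolding flat_poly_def by (simp only: less_irrefl if_False)
    ultimately show ?thesis
      unfolding 3 by (simp only:)
  qed
qed

text \<open>The induction generalises \<open>p\<close> because differentiation replaces it by
  another polynomial.\<close>

lemma k_times_cont_diff_flat_poly:
  "k_times_cont_diff k f \<Longrightarrow> k_times_cont_diff k (\<lambda>x. flat_poly p (f x))"
proof (induction k arbitrary: p)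
  case 0
  have "continuous_on UNIV (flat_poly p)"
    using flat_poly_deriv DERIV_continuous_on by blast
  with 0 show ?case
    by (auto intro: continuous_on_compose2)
next
  case (Suc k)
  then have diff: "f differentiable (at x)" for x by simp
  have "partial i (\<lambda>x. flat_poly p (f x)) =
      (\<lambda>x. flat_poly ([:0, 0, 1:] * (p - pderiv p)) (f x) * partial i f x)" for i
    by (rule ext, rule partial_compose[OF diff flat_poly_deriv])
  moreover have "(\<lambda>x. flat_poly p (f x)) differentiable (at x)" for x
    by (rule partial_compose[OF diff flat_poly_deriv])
  moreover have "k_times_cont_diff k f"
    using Suc.prems by (blast intro: k_times_cont_diff_SucD)
  ultimately show ?case using Suc by (simp add: k_times_cont_diff_mult)
qed

text \<open>This function is the derivative of \<open>flat_poly 1\<close>, that is s^2 exp(-s) with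
  s = 1/t, and exp s \<ge> s^2/2 bounds it. Sign and bound supply both the Lipschitz constant 2 and
  the range of the coefficient in the energy estimate below.\<close>

lemma flat_poly_square_bounds: "0 \<le> flat_poly [:0, 0, 1:] t" "flat_poly [:0, 0, 1:] t \<le> 2"
proof -
  show "0 \<le> flat_poly [:0, 0, 1:] t" by (simp add: flat_poly_def)
  have "s\<^sup>2 \<le> 2 * exp s" if "s > 0" for s :: real
    using exp_lower_Taylor_quadratic[of s] that by simp
  from this[of "1 / t"] show "flat_poly [:0, 0, 1:] t \<le> 2"
    by (auto simp: flat_poly_def exp_minus power2_eq_square divide_simps mult_ac)
qed

lemma flat_poly_1_deriv: "(flat_poly 1 has_real_derivative flat_poly [:0, 0, 1:] t) (at t)"
  using flat_poly_deriv[of 1 t] by (simp add: pderiv_1)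

lemma flat_poly_1_lipschitz: "\<bar>flat_poly 1 s - flat_poly 1 t\<bar> \<le> 2 * \<bar>s - t\<bar>"
proof -
  have "norm (flat_poly [:0, 0, 1:] t) \<le> 2" for t
    using flat_poly_square_bounds[of t] by simp
  from field_differentiable_bound[of UNIV "flat_poly 1" "flat_poly [:0, 0, 1:]", OF convex_UNIV flat_poly_1_deriv this]
  show ?thesis by (simp del: norm_conv_dist)
qed

lemma flat_poly_1_ge_0: "0 \<le> flat_poly 1 t" and flat_poly_1_eq_0_iff: "flat_poly 1 t = 0 \<longleftrightarrow> t \<le> 0"
  by (auto simp: flat_poly_def)

definition smooth :: "('a::euclidean_space \<Rightarrow> real) \<Rightarrow> bool" where
  "smooth f \<longleftrightarrow> (\<forall>k. k_times_cont_diff k f)"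

lemma smooth_const: "smooth (\<lambda>_. c)"
  and smooth_inner: "smooth (\<lambda>x. x \<bullet> a)"
  and smooth_add: "smooth f \<Longrightarrow> smooth g \<Longrightarrow> smooth (\<lambda>x. f x + g x)"
  and smooth_mult: "smooth f \<Longrightarrow> smooth g \<Longrightarrow> smooth (\<lambda>x. f x * g x)"
  and smooth_flat_poly: "smooth f \<Longrightarrow> smooth (\<lambda>x. flat_poly p (f x))"
  unfolding smooth_def
  by (simp_all add: k_times_cont_diff_const k_times_cont_diff_inner k_times_cont_diff_add
      k_times_cont_diff_mult k_times_cont_diff_flat_poly)

lemma smooth_diff: "smooth f \<Longrightarrow> smooth g \<Longrightarrow> smooth (\<lambda>x. f x - g x)"
  using smooth_add[of f "\<lambda>x. - 1 * g x"] smooth_mult[OF smooth_const[of "- 1"], of g] by simp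

lemma smooth_sum: "(\<And>i. i \<in> I \<Longrightarrow> smooth (f i)) \<Longrightarrow> smooth (\<lambda>x. \<Sum>i\<in>I. f i x)"
  by (induction I rule: infinite_finite_induct) (simp_all add: smooth_const smooth_add)

lemma smooth_differentiable: "smooth f \<Longrightarrow> f differentiable (at x)"
  unfolding smooth_def using k_times_cont_diff.simps(2)[of 0 f] by blast

lemma smooth_partial: "smooth f \<Longrightarrow> i \<in> Basis \<Longrightarrow> smooth (partial i f)"
  unfolding smooth_def using k_times_cont_diff.simps(2)[of _ f] by blast

lemma smooth_continuous: "smooth f \<Longrightarrow> continuous_on UNIV f"
  unfolding smooth_def using k_times_cont_diff.simps(1)[of f] by blast

lemma smooth_borel: "smooth f \<Longrightarrow> f \<in> borel_measurable borel"
  by (intro borel_measurable_continuous_onI smooth_continuous)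

section \<open>Integration by parts\<close>

lemma test_functionI:
  assumes "smooth \<phi>" "compact K" "K \<subseteq> \<Omega>" "\<And>x. x \<notin> K \<Longrightarrow> \<phi> x = 0"
  shows "test_function \<Omega> \<phi>"
proof -
  have "support_on UNIV \<phi> \<subseteq> K" using assms(4) by (auto simp: support_on_def)
  then have "closure (support_on UNIV \<phi>) \<subseteq> K" "bounded (support_on UNIV \<phi>)"
    using assms(2) closure_minimal compact_imp_closed compact_imp_bounded bounded_subset by metis+
  then show ?thesis
    using assms(1,3) unfolding test_function_def smooth_def by (auto simp: compact_closure)
qed

lemma test_functionE:
  assumes "test_function \<Omega> \<phi>"
  obtains K where "compact K" "K \<subseteq> \<Omega>" "\<And>x. x \<notin> K \<Longrightarrow> \<phi> x = 0"
proof
  show "compact (closure (support_on UNIV \<phi>))" "closure (support_on UNIV \<phi>) \<subseteq> \<Omega>"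
    using assms by (auto simp: test_function_def)
  show "\<phi> x = 0" if "x \<notin> closure (support_on UNIV \<phi>)" for x
    using that subsetD[OF closure_subset, of x "support_on UNIV \<phi>"] by (auto simp: support_on_def)
qed

lemma test_function_smooth: "test_function \<Omega> \<phi> \<Longrightarrow> smooth \<phi>"
  by (simp add: test_function_def smooth_def)

lemma partial_zero_outside:
  assumes "closed K" "\<And>x. x \<notin> K \<Longrightarrow> f x = 0" "x \<notin> K"
  shows "partial i f x = 0"
proof -
  have "(f has_derivative (\<lambda>_. 0)) (at x)"
    by (rule has_derivative_transform_within_open[of "\<lambda>_. 0" _ _ _ "- K"]) (use assms in auto)
  from partial_eqI[OF this] show ?thesis .
qed

lemma test_function_partial:
  assumes "test_function \<Omega> \<phi>" "i \<in> Basis"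
  shows "test_function \<Omega> (partial i \<phi>)"
proof -
  from assms(1) obtain K where K: "compact K" "K \<subseteq> \<Omega>" "\<And>x. x \<notin> K \<Longrightarrow> \<phi> x = 0"
    by (rule test_functionE) blast
  show ?thesis
    by (rule test_functionI[OF smooth_partial[OF test_function_smooth[OF assms(1)] assms(2)] K(1,2)])
      (rule partial_zero_outside[OF compact_imp_closed[OF K(1)] K(3)])
qed

lemma integrable_compact_support:
  fixes f :: "'a::euclidean_space \<Rightarrow> real"
  assumes "continuous_on UNIV f" "compact K" "\<And>x. x \<notin> K \<Longrightarrow> f x = 0"
  shows "integrable lborel f"
proof -
  have "integrable lborel (\<lambda>x. indicator K x *\<^sub>R f x)"
    using assms(1,2) by (intro borel_integrable_compact) (auto intro: continuous_on_subset)
  moreover have "(\<lambda>x. indicator K x *\<^sub>R f x) = f"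
    using assms(3) by (auto simp: fun_eq_iff indicator_def)
  ultimately show ?thesis by simp
qed

text \<open>Translation invariance makes the integral of every difference quotient in direction
  \<open>i\<close> vanish, and dominated convergence passes to the derivative. This takes the place
  of the divergence theorem.\<close>

lemma integral_partial_eq_0:
  fixes f :: "'a::euclidean_space \<Rightarrow> real"
  assumes f: "smooth f" and K: "compact K" "\<And>x. x \<notin> K \<Longrightarrow> f x = 0" and i: "i \<in> Basis"
  shows "(\<integral>x. partial i f x \<partial>lborel) = 0"
proof -
  define D where "D n x = (f (x + (1 / real (Suc n)) *\<^sub>R i) - f x) / (1 / real (Suc n))" for n x
  have lineD: "((\<lambda>s. f (x + s *\<^sub>R i)) has_real_derivative partial i f (x + s *\<^sub>R i)) (at s)" for x s
  proof -
    let ?f' = "frechet_derivative f (at (x + s *\<^sub>R i))"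
    have f': "(f has_derivative ?f') (at (x + s *\<^sub>R i))"
      using smooth_differentiable[OF f] by (simp add: frechet_derivative_works)
    have "((\<lambda>s. f (x + s *\<^sub>R i)) has_derivative (\<lambda>h. ?f' (h *\<^sub>R i))) (at s)"
      by (rule has_derivative_compose[where g = f and f = "\<lambda>s. x + s *\<^sub>R i", OF _ f']) (auto intro!: derivative_eq_intros)
    moreover have "(\<lambda>h. ?f' (h *\<^sub>R i)) = (*) (partial i f (x + s *\<^sub>R i))"
      using linear_scale[OF has_derivative_linear[OF f']] by (auto simp: partial_def)
    ultimately show ?thesis by (simp add: has_field_derivative_def)
  qed
  have cont: "continuous_on UNIV (partial i f)"
    using smooth_continuous[OF smooth_partial[OF f i]] .
  obtain M where M: "\<And>x. x \<in> K \<Longrightarrow> \<bar>partial i f x\<bar> \<le> M"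
    using compact_imp_bounded[OF compact_continuous_image[OF continuous_on_subset[OF cont] K(1)]]
    unfolding bounded_iff by force
  have M': "\<bar>partial i f x\<bar> \<le> max M 0" for x
  proof (cases "x \<in> K")
    case False
    then show ?thesis
      using partial_zero_outside[of K f x i] K compact_imp_closed by force
  qed (use M in force)
  obtain b where b: "K \<subseteq> cball 0 b"
    using bounded_subset_ballD[OF compact_imp_bounded[OF K(1)], of 0] ball_subset_cball by (metis order_trans)
  \<comment> \<open>The steps have length at most 1, so all quotients vanish outside the ball
    enlarged by 1; inside, the mean value theorem bounds them by the bound on the
    derivative.\<close>
  have D_bound: "norm (D n x) \<le> max M 0 * indicator (cball 0 (b + 1)) x" for n x
  proof (cases "x \<in> cball 0 (b + 1)")
    case True
    have "\<exists>z>0. z < 1 / real (Suc n) \<and> f (x + (1 / real (Suc n)) *\<^sub>R i) - f (x + 0 *\<^sub>R i)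
        = (1 / real (Suc n) - 0) * partial i f (x + z *\<^sub>R i)"
      by (rule MVT2[where f = "\<lambda>s. f (x + s *\<^sub>R i)"]) (auto intro: lineD)
    then obtain z where "D n x = partial i f (x + z *\<^sub>R i)"
      by (auto simp: D_def)
    with M' True show ?thesis by simp
  next
    case False
    have "norm x \<le> norm (x + (1 / real (Suc n)) *\<^sub>R i) + norm ((1 / real (Suc n)) *\<^sub>R i)"
      using norm_triangle_ineq4[of "x + (1 / real (Suc n)) *\<^sub>R i" "(1 / real (Suc n)) *\<^sub>R i"] by simp
    also have "norm ((1 / real (Suc n)) *\<^sub>R i) \<le> 1" using i by simp
    finally have "x \<notin> K" "x + (1 / real (Suc n)) *\<^sub>R i \<notin> K"
      using False b by (auto simp: subset_iff)
    then show ?thesis using K False by (simp add: D_def)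
  qed
  have fint: "integrable lborel f"
    by (rule integrable_compact_support[OF smooth_continuous[OF f] K])
  have shift: "integrable lborel (\<lambda>x. f (x + c))" "(\<integral>x. f (x + c) \<partial>lborel) = (\<integral>x. f x \<partial>lborel)" for c
  proof -
    have "integrable (distr lborel borel ((+) c)) f"
      unfolding lborel_distr_plus by (rule fint)
    then show "integrable lborel (\<lambda>x. f (x + c))"
      using smooth_borel[OF f] by (subst (asm) integrable_distr_eq) (auto simp: add.commute)
    have "(\<integral>x. f x \<partial>lborel) = (\<integral>x. f x \<partial>distr lborel borel ((+) c))"
      unfolding lborel_distr_plus ..
    also have "\<dots> = (\<integral>x. f (x + c) \<partial>lborel)"
      using smooth_borel[OF f] by (subst integral_distr) (auto simp: add.commute)
    finally show "(\<integral>x. f (x + c) \<partial>lborel) = (\<integral>x. f x \<partial>lborel)" ..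
  qed
  have D0: "(\<integral>x. D n x \<partial>lborel) = 0" for n
    unfolding D_def using shift fint by simp
  have "(\<lambda>n. \<integral>x. D n x \<partial>lborel) \<longlonglongrightarrow> (\<integral>x. partial i f x \<partial>lborel)"
  proof (rule integral_dominated_convergence)
    show "partial i f \<in> borel_measurable lborel"
      using smooth_borel[OF smooth_partial[OF f i]] by simp
    show "D n \<in> borel_measurable lborel" for n
      unfolding D_def using shift(1) fint borel_measurable_integrable by measurable
    show "integrable lborel (\<lambda>x::'a. max M 0 * indicator (cball 0 (b + 1)) x)"
      using emeasure_bounded_finite[OF bounded_cball, of "0::'a" "b + 1"]
      by (intro integrable_mult_right integrable_real_indicator) auto
    show "AE x in lborel. norm (D n x) \<le> max M 0 * indicator (cball 0 (b + 1)) x" for n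
      using D_bound by simp
    show "AE x in lborel. (\<lambda>n. D n x) \<longlonglongrightarrow> partial i f x"
    proof (rule AE_I2)
      fix x
      have "((\<lambda>h. (f (x + h *\<^sub>R i) - f x) / h) \<longlongrightarrow> partial i f x) (at 0)"
        using lineD[of x 0] by (simp add: has_field_derivative_iff)
      moreover have "filterlim (\<lambda>n. 1 / real (Suc n)) (at 0) sequentially"
        using LIMSEQ_Suc[OF lim_inverse_n'] by (simp add: filterlim_at)
      ultimately show "(\<lambda>n. D n x) \<longlonglongrightarrow> partial i f x"
        unfolding D_def by (rule filterlim_compose)
    qed
  qed
  then show ?thesis
    unfolding D0 using LIMSEQ_unique tendsto_const by blast
qed

lemma borel_measurable_lebesgue_on:
  "f \<in> borel_measurable borel \<Longrightarrow> f \<in> borel_measurable (lebesgue_on S)"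
  by (simp add: measurable_restrict_space1 measurable_completion)

lemma lebesgue_on_integral_eq:
  fixes f :: "'a::euclidean_space \<Rightarrow> real"
  assumes "open \<Omega>" "f \<in> borel_measurable borel" "\<And>x. x \<notin> \<Omega> \<Longrightarrow> f x = 0"
  shows "(\<integral>x. f x \<partial>lebesgue_on \<Omega>) = (\<integral>x. f x \<partial>lborel)"
proof -
  have "(\<integral>x. f x \<partial>lebesgue_on \<Omega>) = (\<integral>x. indicator \<Omega> x *\<^sub>R f x \<partial>lebesgue)"
    using assms(1) by (intro integral_restrict_space) simp
  also have "(\<lambda>x. indicator \<Omega> x *\<^sub>R f x) = f"
    using assms(3) by (auto simp: fun_eq_iff indicator_def)
  finally show ?thesis
    using assms(2) by (simp add: integral_completion)
qed

lemma integrable_continuous_mult: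
  fixes f h :: "'a::euclidean_space \<Rightarrow> real"
  assumes "bounded \<Omega>" "continuous_on UNIV f" "integrable (lebesgue_on \<Omega>) h"
  shows "integrable (lebesgue_on \<Omega>) (\<lambda>x. f x * h x)"
proof -
  have "bounded (f ` closure \<Omega>)"
    using assms by (intro compact_imp_bounded compact_continuous_image)
      (auto simp: compact_closure intro: continuous_on_subset)
  then obtain b where b: "\<And>x. x \<in> \<Omega> \<Longrightarrow> \<bar>f x\<bar> \<le> b"
    unfolding bounded_iff using subsetD[OF closure_subset] by (metis image_eqI real_norm_def)
  show ?thesis
  proof (rule Bochner_Integration.integrable_bound)
    show "integrable (lebesgue_on \<Omega>) (\<lambda>x. b * h x)" using assms by simp
    show "(\<lambda>x. f x * h x) \<in> borel_measurable (lebesgue_on \<Omega>)"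
      using borel_measurable_lebesgue_on[OF borel_measurable_continuous_onI[OF assms(2)]]
        borel_measurable_integrable[OF assms(3)] by measurable
    show "AE x in lebesgue_on \<Omega>. norm (f x * h x) \<le> norm (b * h x)"
    proof (rule AE_I2)
      fix x assume "x \<in> space (lebesgue_on \<Omega>)"
      then have "\<bar>f x\<bar> \<le> \<bar>b\<bar>" using b[of x] by (simp add: space_restrict_space)
      then show "norm (f x * h x) \<le> norm (b * h x)"
        by (simp add: abs_mult mult_right_mono)
    qed
  qed
qed

lemma finite_measure_lebesgue_on_open:
  assumes "open \<Omega>" "bounded \<Omega>" shows "finite_measure (lebesgue_on \<Omega>)"
  using assms by (intro finite_measure_lebesgue_on lmeasurable_open)

lemma integrable_continuous:
  fixes f :: "'a::euclidean_space \<Rightarrow> real"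
  assumes "open \<Omega>" "bounded \<Omega>" "continuous_on UNIV f"
  shows "integrable (lebesgue_on \<Omega>) f"
proof -
  interpret finite_measure "lebesgue_on \<Omega>" using assms(1,2) by (rule finite_measure_lebesgue_on_open)
  show ?thesis using integrable_continuous_mult[OF assms(2,3), of "\<lambda>_. 1"] by simp
qed

text \<open>The product of \<open>w\<close> and \<open>v\<close> inherits compact support in
  \<Omega> from \<open>w\<close>, so the integral of its derivative vanishes; the product rule
  splits it.\<close>

lemma integral_by_parts:
  fixes w v :: "'a::euclidean_space \<Rightarrow> real"
  assumes \<Omega>: "open \<Omega>" "bounded \<Omega>" and w: "test_function \<Omega> w" and v: "smooth v" and i: "i \<in> Basis"
  shows "(\<integral>x. partial i v x * w x \<partial>lebesgue_on \<Omega>) = - (\<integral>x. v x * partial i w x \<partial>lebesgue_on \<Omega>)"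
proof -
  note sw = test_function_smooth[OF w]
  define p where "p = (\<lambda>x. w x * v x)"
  have p: "smooth p" unfolding p_def by (intro smooth_mult sw v)
  from w obtain K where K: "compact K" "K \<subseteq> \<Omega>" "\<And>x. x \<notin> K \<Longrightarrow> p x = 0"
    unfolding p_def by (rule test_functionE) auto
  have zero: "partial i p x = 0" if "x \<notin> \<Omega>" for x
    using partial_zero_outside[where f = p and K = K] compact_imp_closed[OF K(1)] K(2,3) that by blast
  have "(\<integral>x. partial i p x \<partial>lebesgue_on \<Omega>) = (\<integral>x. partial i p x \<partial>lborel)"
    using zero by (intro lebesgue_on_integral_eq \<Omega> smooth_borel smooth_partial i p)
  also have "\<dots> = 0"
    by (rule integral_partial_eq_0[OF p K(1,3) i])
  also have "partial i p = (\<lambda>x. v x * partial i w x + partial i v x * w x)"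
    unfolding p_def using smooth_differentiable[OF sw] smooth_differentiable[OF v]
    by (auto simp: partial_mult mult.commute)
  finally have "(\<integral>x. v x * partial i w x + partial i v x * w x \<partial>lebesgue_on \<Omega>) = 0" .
  moreover have "integrable (lebesgue_on \<Omega>) (\<lambda>x. v x * partial i w x)"
    "integrable (lebesgue_on \<Omega>) (\<lambda>x. partial i v x * w x)"
    by (intro integrable_continuous \<Omega> continuous_on_mult smooth_continuous smooth_partial sw v i)+
  ultimately show ?thesis by simp
qed

section \<open>Comparison with strict subsolutions\<close>

lemma L2_integrable:
  fixes f :: "'a::euclidean_space \<Rightarrow> 'b::euclidean_space"
  assumes "open \<Omega>" "bounded \<Omega>" "L2 \<Omega> f"
  shows "integrable (lebesgue_on \<Omega>) f"
proof -
  interpret finite_measure "lebesgue_on \<Omega>" using assms(1,2) by (rule finite_measure_lebesgue_on_open)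
  have f: "f \<in> borel_measurable (lebesgue_on \<Omega>)" "integrable (lebesgue_on \<Omega>) (\<lambda>x. 1 + (norm (f x))\<^sup>2)"
    using assms(3) by (auto simp: L2_def)
  have le: "t \<le> 1 + t\<^sup>2" if "0 \<le> t" for t :: real
  proof -
    have "2 * t \<le> 1 + t\<^sup>2" using zero_le_power2[of "t - 1"] by (simp add: power2_diff)
    with that show ?thesis by simp
  qed
  show ?thesis
  proof (rule Bochner_Integration.integrable_bound[OF f(2,1)], rule AE_I2)
    show "norm (f x) \<le> norm (1 + (norm (f x))\<^sup>2)" for x
      using le[OF norm_ge_zero, of "f x"] by simp
  qed
qed

lemma L2_diff:
  fixes f g :: "'a::euclidean_space \<Rightarrow> 'b::euclidean_space"
  assumes "L2 \<Omega> f" "L2 \<Omega> g"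
  shows "L2 \<Omega> (\<lambda>x. f x - g x)"
proof -
  have m: "f \<in> borel_measurable (lebesgue_on \<Omega>)" "g \<in> borel_measurable (lebesgue_on \<Omega>)"
    and i: "integrable (lebesgue_on \<Omega>) (\<lambda>x. 2 * (norm (f x))\<^sup>2 + 2 * (norm (g x))\<^sup>2)"
    using assms by (auto simp: L2_def)
  have m': "(\<lambda>x. f x - g x) \<in> borel_measurable (lebesgue_on \<Omega>)"
    using m by measurable
  have le: "(norm (a - b))\<^sup>2 \<le> 2 * (norm a)\<^sup>2 + 2 * (norm b)\<^sup>2" for a b :: 'b
    using zero_le_power2[of "norm (a + b)"] unfolding power2_norm_eq_inner
    by (simp add: inner_simps inner_commute)
  have "integrable (lebesgue_on \<Omega>) (\<lambda>x. (norm (f x - g x))\<^sup>2)"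
    using m' by (intro Bochner_Integration.integrable_bound[OF i] AE_I2) (auto intro: le)
  with m' show ?thesis by (simp add: L2_def)
qed

lemma grad_inner: "i \<in> Basis \<Longrightarrow> grad f x \<bullet> i = partial i f x"
  by (simp add: grad_def inner_sum_left inner_Basis if_distrib cong: if_cong)

lemma L2_continuous:
  fixes f :: "'a::euclidean_space \<Rightarrow> 'b::euclidean_space"
  assumes "open \<Omega>" "bounded \<Omega>" "continuous_on UNIV f"
  shows "L2 \<Omega> f"
  unfolding L2_def
  by (intro conjI borel_measurable_lebesgue_on borel_measurable_continuous_onI
      integrable_continuous continuous_on_power continuous_on_norm assms)

lemma continuous_on_grad: "smooth f \<Longrightarrow> continuous_on UNIV (grad f)"
  unfolding grad_def by (intro continuous_intros smooth_continuous smooth_partial)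

text \<open>Inserting the derivatives of \<open>w\<close> as test functions into
  \<open>weak_gradient\<close> moves one derivative of the laplacian onto \<open>u\<close>. The
  equation is thereby expressed through \<open>g\<close>, which is the L2 limit of the gradients of
  the approximants.\<close>

lemma weak_formulation:
  fixes u :: "'a::euclidean_space \<Rightarrow> real"
  assumes \<Omega>: "open \<Omega>" "bounded \<Omega>" and u: "L2 \<Omega> u" and g: "L2 \<Omega> g" "weak_gradient \<Omega> u g"
    and lap: "weak_laplacian \<Omega> u (\<lambda>_. -1)" and w: "test_function \<Omega> w"
  shows "(\<Sum>i\<in>Basis. \<integral>x. (g x \<bullet> i) * partial i w x \<partial>lebesgue_on \<Omega>) = (\<integral>x. w x \<partial>lebesgue_on \<Omega>)"
proof -
  note sw = test_function_smooth[OF w]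
  have int: "integrable (lebesgue_on \<Omega>) (\<lambda>x. u x * partial i (partial i w) x)" if "i \<in> Basis" for i
    using integrable_continuous_mult[OF \<Omega>(2) smooth_continuous[OF smooth_partial[OF smooth_partial[OF sw]]]
        L2_integrable[OF \<Omega> u], of i i] that by (simp add: mult.commute)
  have "- (\<integral>x. w x \<partial>lebesgue_on \<Omega>) = (\<integral>x. u x * laplacian w x \<partial>lebesgue_on \<Omega>)"
    using lap w by (simp add: weak_laplacian_def)
  also have "\<dots> = (\<Sum>i\<in>Basis. \<integral>x. u x * partial i (partial i w) x \<partial>lebesgue_on \<Omega>)"
    using int by (simp add: laplacian_def sum_distrib_left)
  also have "\<dots> = (\<Sum>i\<in>Basis. - (\<integral>x. (g x \<bullet> i) * partial i w x \<partial>lebesgue_on \<Omega>))"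
    using g(2) test_function_partial[OF w] by (intro sum.cong refl) (simp add: weak_gradient_def)
  finally show ?thesis by (simp add: sum_negf)
qed

text \<open>Test the equation with \<open>flat_poly 1 (v - \<phi>)\<close>, a smooth substitute for the positive part of
  \<open>v - \<phi>\<close>.\<close>

lemma excess_le_gradient_error:
  fixes u v :: "'a::euclidean_space \<Rightarrow> real"
  assumes \<Omega>: "open \<Omega>" "bounded \<Omega>" and u: "L2 \<Omega> u" and g: "L2 \<Omega> g" "weak_gradient \<Omega> u g"
    and lap: "weak_laplacian \<Omega> u (\<lambda>_. -1)"
    and v: "smooth v" "\<And>x. laplacian v x \<ge> - \<theta>" "compact K" "K \<subseteq> \<Omega>" "\<And>x. x \<notin> K \<Longrightarrow> v x \<le> 0"
    and \<phi>: "test_function \<Omega> \<phi>"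
  shows "(1 - \<theta>) * (\<integral>x. flat_poly 1 (v x - \<phi> x) \<partial>lebesgue_on \<Omega>)
    \<le> (\<integral>x. (norm (grad \<phi> x - g x))\<^sup>2 \<partial>lebesgue_on \<Omega>)"
proof -
  note s\<phi> = test_function_smooth[OF \<phi>]
  define w where "w x = flat_poly 1 (v x - \<phi> x)" for x
  define P where "P x = flat_poly [:0, 0, 1:] (v x - \<phi> x)" for x
  have P: "0 \<le> P x" "P x \<le> 2" for x
    unfolding P_def by (rule flat_poly_square_bounds)+
  have sw: "smooth w"
    unfolding w_def by (intro smooth_flat_poly smooth_diff v(1) s\<phi>)
  obtain L where L: "compact L" "L \<subseteq> \<Omega>" "\<And>x. x \<notin> L \<Longrightarrow> \<phi> x = 0"
    using test_functionE[OF \<phi>] by metis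
  \<comment> \<open>Outside \<open>K\<close> and \<open>L\<close> one has v \<le> 0 = \<phi>, and
    the cutoff vanishes for non-positive arguments.\<close>
  have w: "test_function \<Omega> w"
  proof (rule test_functionI[OF sw])
    show "compact (K \<union> L)" "K \<union> L \<subseteq> \<Omega>" using v(3,4) L(1,2) by auto
    show "w x = 0" if "x \<notin> K \<union> L" for x
      using that v(5)[of x] L(3)[of x] by (simp add: w_def flat_poly_1_eq_0_iff)
  qed
  have w0: "0 \<le> w x" for x by (simp add: w_def flat_poly_1_ge_0)
  have pw: "partial i w x = P x * (partial i v x - partial i \<phi> x)" for i x
  proof -
    have d: "(\<lambda>x. v x - \<phi> x) differentiable (at x)"
      by (rule smooth_differentiable[OF smooth_diff[OF v(1) s\<phi>]])
    have "partial i (\<lambda>x. v x - \<phi> x) x = partial i v x - partial i \<phi> x"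
      using has_derivative_diff[OF smooth_differentiable[OF v(1), unfolded frechet_derivative_works]
          smooth_differentiable[OF s\<phi>, unfolded frechet_derivative_works]]
      by (subst partial_eqI, assumption) (simp add: partial_def)
    then show ?thesis
      unfolding w_def P_def using partial_compose(1)[OF d flat_poly_1_deriv] by simp
  qed
  let ?M = "lebesgue_on \<Omega>"
  note cont = smooth_continuous[OF sw] smooth_continuous[OF smooth_partial[OF v(1)]]
    smooth_continuous[OF smooth_partial[OF sw]] smooth_continuous[OF smooth_partial[OF smooth_partial[OF v(1)]]]
  have intw: "integrable ?M w" by (rule integrable_continuous[OF \<Omega> cont(1)])
  have intg: "integrable ?M (\<lambda>x. (g x \<bullet> i) * partial i w x)" if "i \<in> Basis" for i
    using integrable_continuous_mult[OF \<Omega>(2) cont(3)[OF that], of "\<lambda>x. g x \<bullet> i"] L2_integrable[OF \<Omega> g(1)]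
    by (simp add: mult.commute)
  have intv: "integrable ?M (\<lambda>x. partial i v x * partial i w x)" if "i \<in> Basis" for i
    by (intro integrable_continuous \<Omega> continuous_on_mult cont that)
  have intvv: "integrable ?M (\<lambda>x. partial i (partial i v) x * w x)" if "i \<in> Basis" for i
    by (intro integrable_continuous \<Omega> continuous_on_mult cont that)
  have e: "(\<Sum>i\<in>Basis. \<integral>x. partial i v x * partial i w x \<partial>?M) = - (\<integral>x. laplacian v x * w x \<partial>?M)"
  proof -
    have "(\<Sum>i\<in>Basis. \<integral>x. partial i v x * partial i w x \<partial>?M)
        = (\<Sum>i\<in>Basis. - (\<integral>x. partial i (partial i v) x * w x \<partial>?M))"
      using integral_by_parts[OF \<Omega> w smooth_partial[OF v(1)]] by (intro sum.cong refl) simp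
    also have "\<dots> = - (\<integral>x. laplacian v x * w x \<partial>?M)"
      using intvv by (simp add: laplacian_def sum_distrib_right sum_negf)
    finally show ?thesis .
  qed
  have "- \<theta> * (\<integral>x. w x \<partial>?M) = (\<integral>x. - \<theta> * w x \<partial>?M)" by simp
  also have "\<dots> \<le> (\<integral>x. laplacian v x * w x \<partial>?M)"
  proof (intro integral_mono)
    show "integrable ?M (\<lambda>x. - \<theta> * w x)" using intw by simp
    show "integrable ?M (\<lambda>x. laplacian v x * w x)"
      unfolding laplacian_def sum_distrib_right using intvv by (intro Bochner_Integration.integrable_sum)
    show "- \<theta> * w x \<le> laplacian v x * w x" for x
      using v(2) w0 by (intro mult_right_mono)
  qed
  finally have "(1 - \<theta>) * (\<integral>x. w x \<partial>?M)
      \<le> (\<integral>x. w x \<partial>?M) - (\<Sum>i\<in>Basis. \<integral>x. partial i v x * partial i w x \<partial>?M)"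
    unfolding e by (simp add: algebra_simps)
  also have "\<dots> = (\<Sum>i\<in>Basis. \<integral>x. (g x \<bullet> i) * partial i w x \<partial>?M)
      - (\<Sum>i\<in>Basis. \<integral>x. partial i v x * partial i w x \<partial>?M)"
    using weak_formulation[OF \<Omega> u g lap w] by simp
  also have "\<dots> = (\<integral>x. (\<Sum>i\<in>Basis. (g x \<bullet> i) * partial i w x - partial i v x * partial i w x) \<partial>?M)"
    using intg intv by (simp add: sum_subtractf)
  also have "\<dots> \<le> (\<integral>x. (norm (grad \<phi> x - g x))\<^sup>2 \<partial>?M)"
  proof (intro integral_mono)
    show "integrable ?M (\<lambda>x. \<Sum>i\<in>Basis. (g x \<bullet> i) * partial i w x - partial i v x * partial i w x)"
      using intg intv by simp
    show "integrable ?M (\<lambda>x. (norm (grad \<phi> x - g x))\<^sup>2)"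
      using L2_diff[OF L2_continuous[OF \<Omega> continuous_on_grad[OF s\<phi>]] g(1)] by (simp add: L2_def)
    fix x
    \<comment> \<open>Here a is a component of g - grad \<phi>, b one of grad v - grad \<phi>, and p
      the derivative of the cutoff. Completing the square removes b, so no bound on the gradient of
      \<open>v\<close> enters.\<close>
    have le: "p * ((a - b) * b) \<le> a\<^sup>2" if "0 \<le> p" "p \<le> 2" for a b p :: real
    proof -
      have "a\<^sup>2 / 2 - (a - b) * b = ((a - b)\<^sup>2 + b\<^sup>2) / 2"
        by (simp add: power2_eq_square algebra_simps)
      moreover have "0 \<le> ((a - b)\<^sup>2 + b\<^sup>2) / 2" by simp
      ultimately have "(a - b) * b \<le> a\<^sup>2 / 2" by linarith
      then have "p * ((a - b) * b) \<le> p * (a\<^sup>2 / 2)" using that(1) by (rule mult_left_mono)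
      also have "\<dots> \<le> 2 * (a\<^sup>2 / 2)" using that(2) by (rule mult_right_mono) simp
      finally show ?thesis by simp
    qed
    have "(\<Sum>i\<in>Basis. (g x \<bullet> i) * partial i w x - partial i v x * partial i w x)
        \<le> (\<Sum>i\<in>Basis. ((grad \<phi> x - g x) \<bullet> i)\<^sup>2)"
    proof (rule sum_mono)
      fix i :: 'a assume i: "i \<in> Basis"
      have "(g x \<bullet> i) * partial i w x - partial i v x * partial i w x
        = P x * (((g x \<bullet> i - partial i \<phi> x) - (partial i v x - partial i \<phi> x)) * (partial i v x - partial i \<phi> x))"
        unfolding pw by (simp add: algebra_simps)
      also have "\<dots> \<le> (g x \<bullet> i - partial i \<phi> x)\<^sup>2" by (rule le[OF P])
      also have "\<dots> = ((grad \<phi> x - g x) \<bullet> i)\<^sup>2"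
        using i by (simp add: inner_diff_left grad_inner power2_commute)
      finally show "(g x \<bullet> i) * partial i w x - partial i v x * partial i w x \<le> ((grad \<phi> x - g x) \<bullet> i)\<^sup>2" .
    qed
    also have "\<dots> = (norm (grad \<phi> x - g x))\<^sup>2"
      unfolding power2_norm_eq_inner euclidean_inner[of "grad \<phi> x - g x" "grad \<phi> x - g x"]
      by (simp only: power2_eq_square)
    finally show "(\<Sum>i\<in>Basis. (g x \<bullet> i) * partial i w x - partial i v x * partial i w x)
        \<le> (norm (grad \<phi> x - g x))\<^sup>2" .
  qed
  finally show ?thesis by (simp only: w_def)
qed

text \<open>The smoothed excess of \<open>v\<close> over the k-th approximant has integral at most
  \<epsilon>_k / (1 - \<theta>). The Lipschitz bound on \<open>flat_poly 1\<close> exchanges the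
  approximant for \<open>u\<close> at the cost of an L1 distance, and |t| \<le> \<eta> + t^2/\<eta>
  controls that by the squared L2 distance. Letting k grow first and \<eta> shrink afterwards leaves
  excess 0.\<close>

lemma strict_subsolution_le:
  fixes u v :: "'a::euclidean_space \<Rightarrow> real"
  assumes \<Omega>: "open \<Omega>" "bounded \<Omega>" and u: "u \<in> W012 \<Omega>" "weak_laplacian \<Omega> u (\<lambda>_. -1)"
    and v: "smooth v" "\<And>x. laplacian v x \<ge> - \<theta>" "\<theta> < 1" "compact K" "K \<subseteq> \<Omega>" "\<And>x. x \<notin> K \<Longrightarrow> v x \<le> 0"
  shows "AE x in lebesgue_on \<Omega>. v x \<le> u x"
proof -
  let ?M = "lebesgue_on \<Omega>"
  interpret finite_measure ?M using \<Omega> by (rule finite_measure_lebesgue_on_open)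
  obtain g \<phi> where L2u: "L2 \<Omega> u" and g: "L2 \<Omega> g" "weak_gradient \<Omega> u g"
    and \<phi>: "\<And>k::nat. test_function \<Omega> (\<phi> k)"
    and lim: "(\<lambda>k. \<integral>x. (\<phi> k x - u x)\<^sup>2 + (norm (grad (\<phi> k) x - g x))\<^sup>2 \<partial>?M) \<longlonglongrightarrow> 0"
    using u(1) unfolding W012_def by blast
  define \<epsilon> where "\<epsilon> k = (\<integral>x. (\<phi> k x - u x)\<^sup>2 + (norm (grad (\<phi> k) x - g x))\<^sup>2 \<partial>?M)" for k
  note s\<phi> = test_function_smooth[OF \<phi>]
  have int_u: "integrable ?M (\<lambda>x. (\<phi> k x - u x)\<^sup>2)" for k
    using L2_diff[OF L2_continuous[OF \<Omega> smooth_continuous[OF s\<phi>]] L2u, of k] by (simp add: L2_def)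
  have int_g: "integrable ?M (\<lambda>x. (norm (grad (\<phi> k) x - g x))\<^sup>2)" for k
    using L2_diff[OF L2_continuous[OF \<Omega> continuous_on_grad[OF s\<phi>]] g(1), of k] by (simp add: L2_def)
  have \<epsilon>_u: "(\<integral>x. (\<phi> k x - u x)\<^sup>2 \<partial>?M) \<le> \<epsilon> k" and \<epsilon>_g: "(\<integral>x. (norm (grad (\<phi> k) x - g x))\<^sup>2 \<partial>?M) \<le> \<epsilon> k" for k
    unfolding \<epsilon>_def using int_u[of k] int_g[of k] by (auto intro!: Bochner_Integration.integral_nonneg_AE)
  have v_meas: "v \<in> borel_measurable ?M" using smooth_borel[OF v(1)] by (rule borel_measurable_lebesgue_on)
  have flat_meas: "flat_poly 1 \<in> borel_measurable borel"
    by (intro borel_measurable_continuous_onI DERIV_continuous_on[where D = "flat_poly [:0, 0, 1:]"] flat_poly_1_deriv)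
  have u_meas: "u \<in> borel_measurable ?M" using L2u by (simp add: L2_def)
  have F_meas: "(\<lambda>x. flat_poly 1 (v x - u x)) \<in> borel_measurable ?M"
    using v_meas u_meas by (intro measurable_compose[OF _ flat_meas] borel_measurable_diff)
  have F_int: "integrable ?M (\<lambda>x. flat_poly 1 (v x - u x))"
    by (rule integrable_const_bound[of _ 1, OF AE_I2 F_meas]) (auto simp: flat_poly_def)
  have bound: "(\<integral>x. flat_poly 1 (v x - u x) \<partial>?M)
      \<le> \<epsilon> k / (1 - \<theta>) + 2 * (\<eta> * measure ?M (space ?M) + \<epsilon> k / \<eta>)" if \<eta>: "\<eta> > 0" for k \<eta>
  proof -
    have int_w: "integrable ?M (\<lambda>x. flat_poly 1 (v x - \<phi> k x))"
      by (intro integrable_continuous \<Omega> smooth_continuous smooth_flat_poly smooth_diff v(1) s\<phi>)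
    have "(\<integral>x. flat_poly 1 (v x - u x) \<partial>?M)
      \<le> (\<integral>x. flat_poly 1 (v x - \<phi> k x) + 2 * (\<eta> + (\<phi> k x - u x)\<^sup>2 / \<eta>) \<partial>?M)"
    proof (intro integral_mono F_int)
      show "integrable ?M (\<lambda>x. flat_poly 1 (v x - \<phi> k x) + 2 * (\<eta> + (\<phi> k x - u x)\<^sup>2 / \<eta>))"
        using int_w int_u[of k] by simp
      fix x
      have "\<bar>\<phi> k x - u x\<bar> \<le> \<eta> + (\<phi> k x - u x)\<^sup>2 / \<eta>"
      proof -
        have "\<bar>t\<bar> * \<eta> \<le> \<eta>\<^sup>2 + t\<^sup>2" for t
        proof -
          have "2 * (\<bar>t\<bar> * \<eta>) \<le> \<eta>\<^sup>2 + t\<^sup>2"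
            using zero_le_power2[of "\<bar>t\<bar> - \<eta>"] by (simp add: power2_diff)
          moreover have "0 \<le> \<bar>t\<bar> * \<eta>" using \<eta> by simp
          ultimately show ?thesis by linarith
        qed
        from this[of "\<phi> k x - u x"] show ?thesis
          using \<eta> by (simp add: field_simps power2_eq_square)
      qed
      moreover have "\<bar>flat_poly 1 (v x - u x) - flat_poly 1 (v x - \<phi> k x)\<bar> \<le> 2 * \<bar>\<phi> k x - u x\<bar>"
        using flat_poly_1_lipschitz[of "v x - u x" "v x - \<phi> k x"] by simp
      ultimately have "\<bar>flat_poly 1 (v x - u x) - flat_poly 1 (v x - \<phi> k x)\<bar> \<le> 2 * (\<eta> + (\<phi> k x - u x)\<^sup>2 / \<eta>)"
        by (meson mult_left_mono order_trans zero_le_numeral)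
      then show "flat_poly 1 (v x - u x) \<le> flat_poly 1 (v x - \<phi> k x) + 2 * (\<eta> + (\<phi> k x - u x)\<^sup>2 / \<eta>)"
        by (simp only: abs_le_iff diff_le_eq add.commute)
    qed
    also have "\<dots> = (\<integral>x. flat_poly 1 (v x - \<phi> k x) \<partial>?M)
        + 2 * (\<eta> * measure ?M (space ?M) + (\<integral>x. (\<phi> k x - u x)\<^sup>2 \<partial>?M) / \<eta>)"
      using int_w int_u[of k] by simp
    also have "\<dots> \<le> \<epsilon> k / (1 - \<theta>) + 2 * (\<eta> * measure ?M (space ?M) + \<epsilon> k / \<eta>)"
    proof (intro add_mono mult_left_mono divide_right_mono \<epsilon>_u)
      have "(1 - \<theta>) * (\<integral>x. flat_poly 1 (v x - \<phi> k x) \<partial>?M) \<le> \<epsilon> k"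
        using excess_le_gradient_error[OF \<Omega> L2u g u(2) v(1,2,4,5,6) \<phi>] \<epsilon>_g by (rule order_trans)
      then show "(\<integral>x. flat_poly 1 (v x - \<phi> k x) \<partial>?M) \<le> \<epsilon> k / (1 - \<theta>)"
        using v(3) by (simp add: field_simps)
    qed (use \<eta> in auto)
    finally show ?thesis .
  qed
  have "(\<integral>x. flat_poly 1 (v x - u x) \<partial>?M) \<le> \<eta> * (2 * measure ?M (space ?M))" if "\<eta> > 0" for \<eta>
  proof (rule LIMSEQ_le_const)
    have "(\<lambda>k. \<epsilon> k / (1 - \<theta>) + 2 * (\<eta> * measure ?M (space ?M) + \<epsilon> k / \<eta>))
      \<longlonglongrightarrow> 0 / (1 - \<theta>) + 2 * (\<eta> * measure ?M (space ?M) + 0 / \<eta>)"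
      using lim that v(3) unfolding \<epsilon>_def[symmetric] by (intro tendsto_intros) auto
    then show "(\<lambda>k. \<epsilon> k / (1 - \<theta>) + 2 * (\<eta> * measure ?M (space ?M) + \<epsilon> k / \<eta>))
      \<longlonglongrightarrow> \<eta> * (2 * measure ?M (space ?M))" by (simp add: mult.left_commute)
  qed (use bound[OF that] in blast)
  then have "(\<integral>x. flat_poly 1 (v x - u x) \<partial>?M) \<le> 0"
    by (intro tendsto_lowerbound[of "\<lambda>\<eta>. \<eta> * (2 * measure ?M (space ?M))" 0 "at_right 0"])
      (auto intro!: tendsto_eq_intros simp: eventually_at_filter)
  moreover have "0 \<le> (\<integral>x. flat_poly 1 (v x - u x) \<partial>?M)"
    by (intro Bochner_Integration.integral_nonneg flat_poly_1_ge_0)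
  ultimately have "AE x in ?M. flat_poly 1 (v x - u x) = 0"
    using integral_nonneg_eq_0_iff_AE[OF F_int] flat_poly_1_ge_0 by simp
  then show ?thesis by (simp add: flat_poly_1_eq_0_iff)
qed

section \<open>Paraboloids as barriers on balls\<close>

lemma paraboloid:
  fixes c :: "'a::euclidean_space"
  defines "q \<equiv> \<lambda>x. (norm (x - c))\<^sup>2"
  shows smooth_paraboloid: "smooth q"
    and laplacian_paraboloid: "laplacian (\<lambda>x. a - b * q x) x = - 2 * b * DIM('a)"
proof -
  have "q = (\<lambda>x. \<Sum>i\<in>Basis. (x \<bullet> i - c \<bullet> i) * (x \<bullet> i - c \<bullet> i))"
    unfolding q_def power2_norm_eq_inner
    by (rule ext, subst euclidean_inner) (simp add: inner_diff_left)
  then show "smooth q"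
    by (simp only:) (intro smooth_sum smooth_mult smooth_diff smooth_inner smooth_const)
  have 1: "partial i (\<lambda>x. a - b * q x) = (\<lambda>x. - 2 * b * ((x - c) \<bullet> i))" for i
  proof (rule ext)
    fix x
    have "((\<lambda>x. a - b * q x) has_derivative (\<lambda>h. - 2 * b * ((x - c) \<bullet> h))) (at x)"
      unfolding q_def power2_norm_eq_inner
      by (auto intro!: derivative_eq_intros simp: inner_commute algebra_simps)
    from partial_eqI[OF this] show "partial i (\<lambda>x. a - b * q x) x = - 2 * b * ((x - c) \<bullet> i)" .
  qed
  have 2: "partial i (\<lambda>x. - 2 * b * ((x - c) \<bullet> i)) x = - 2 * b" if "i \<in> Basis" for i
  proof -
    have "((\<lambda>x. - 2 * b * ((x - c) \<bullet> i)) has_derivative (\<lambda>h. - 2 * b * (h \<bullet> i))) (at x)"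
      by (auto intro!: derivative_eq_intros)
    from partial_eqI[OF this, of i] show ?thesis using that by simp
  qed
  show "laplacian (\<lambda>x. a - b * q x) x = - 2 * b * DIM('a)"
    unfolding laplacian_def 1 using 2 by simp
qed

text \<open>The coefficient \<open>b\<close> makes the laplacian exactly -\<theta>, so the
  paraboloid is a strict subsolution, and it is non-positive off the closed ball, which serves as
  the compact set in the comparison. The factor \<theta> and the closedness of the ball are the
  price, both removed by a limit below.\<close>

lemma torsion_ge_ball_rational:
  fixes u :: "'a::euclidean_space \<Rightarrow> real"
  assumes \<Omega>: "open \<Omega>" "bounded \<Omega>" and u: "u \<in> W012 \<Omega>" "weak_laplacian \<Omega> u (\<lambda>_. -1)"
    and "cball c r \<subseteq> \<Omega>" "0 \<le> r" "0 < \<theta>" "\<theta> < 1"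
  shows "AE x in lebesgue_on \<Omega>. \<theta> * (r\<^sup>2 - (norm (x - c))\<^sup>2) / (2 * DIM('a)) \<le> u x"
proof -
  define b where "b = \<theta> / (2 * real DIM('a))"
  have b: "b > 0" using assms by (simp add: b_def)
  have "AE x in lebesgue_on \<Omega>. b * r\<^sup>2 - b * (norm (x - c))\<^sup>2 \<le> u x"
  proof (rule strict_subsolution_le[OF \<Omega> u _ _ assms(8) compact_cball assms(5)])
    show "smooth (\<lambda>x. b * r\<^sup>2 - b * (norm (x - c))\<^sup>2)"
      by (intro smooth_diff smooth_mult smooth_const smooth_paraboloid)
    show "- \<theta> \<le> laplacian (\<lambda>x. b * r\<^sup>2 - b * (norm (x - c))\<^sup>2) x" for x
      unfolding laplacian_paraboloid by (simp add: b_def)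
    show "b * r\<^sup>2 - b * (norm (x - c))\<^sup>2 \<le> 0" if "x \<notin> cball c r" for x
    proof -
      have "r\<^sup>2 \<le> (norm (x - c))\<^sup>2"
        using that assms(6) by (intro power_mono) (auto simp: dist_norm norm_minus_commute)
      then show ?thesis using b by simp
    qed
  qed
  then show ?thesis by (simp add: b_def algebra_simps diff_divide_distrib)
qed

text \<open>The exceptional null set is chosen independently of the ball by restricting to countably many
  balls first.\<close>

lemma torsion_ge_ball:
  fixes u :: "'a::euclidean_space \<Rightarrow> real"
  assumes \<Omega>: "open \<Omega>" "bounded \<Omega>" and u: "u \<in> W012 \<Omega>" "weak_laplacian \<Omega> u (\<lambda>_. -1)"
  shows "AE x in lebesgue_on \<Omega>. \<forall>c r. 0 < r \<longrightarrow> ball c r \<subseteq> \<Omega> \<longrightarrow>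
    (r\<^sup>2 - (norm (x - c))\<^sup>2) / (2 * DIM('a)) \<le> u x"
proof -
  obtain X :: "'a set" where X: "countable X" "\<And>U. open U \<Longrightarrow> U \<noteq> {} \<Longrightarrow> \<exists>d\<in>X. d \<in> U"
    using countable_dense_exists by metis
  define I where "I = {(c, r, \<theta>). c \<in> X \<and> r \<in> \<rat> \<and> \<theta> \<in> \<rat> \<and> cball c r \<subseteq> \<Omega> \<and> 0 \<le> r \<and> 0 < \<theta> \<and> \<theta> < (1::real)}"
  have "countable I"
    by (rule countable_subset[of _ "X \<times> \<rat> \<times> \<rat>"]) (auto simp: I_def intro: X(1) countable_rat)
  moreover have "AE x in lebesgue_on \<Omega>. \<theta> * (r\<^sup>2 - (norm (x - c))\<^sup>2) / (2 * DIM('a)) \<le> u x"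
    if "(c, r, \<theta>) \<in> I" for c r \<theta>
    using that torsion_ge_ball_rational[OF assms] unfolding I_def by blast
  ultimately have "AE x in lebesgue_on \<Omega>. \<forall>(c, r, \<theta>)\<in>I. \<theta> * (r\<^sup>2 - (norm (x - c))\<^sup>2) / (2 * DIM('a)) \<le> u x"
    by (subst AE_ball_countable) auto
  then show ?thesis
  proof (rule AE_mp, intro AE_I2 impI allI)
    fix x c and r :: real
    assume I: "\<forall>(c, r, \<theta>)\<in>I. \<theta> * (r\<^sup>2 - (norm (x - c))\<^sup>2) / (2 * DIM('a)) \<le> u x"
      and r: "0 < r" "ball c r \<subseteq> \<Omega>"
    have "\<exists>d \<rho> \<theta>. (d, \<rho>, \<theta>) \<in> I \<and> dist d c < 1 / Suc n \<and> \<bar>\<rho> - r\<bar> < 4 / Suc n \<and> \<bar>\<theta> - 1\<bar> < 1 / Suc n"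
      if n: "real (Suc n) > 4 / r" for n
    proof -
      \<comment> \<open>Shrinking the radius by more than 2e compensates the shift of the centre by
        less than e, so the approximating closed ball stays in \<open>ball c r\<close>. The
        conditions 4e < r and e \<le> 1 keep \<rho> and \<theta> positive.\<close>
      define e where "e = 1 / real (Suc n)"
      have e: "0 < e" "e \<le> 1" "4 * e < r"
        using n r(1) by (auto simp: e_def field_simps)
      obtain d where d: "d \<in> X" "d \<in> ball c e" using X(2)[of "ball c e"] e by auto
      obtain \<rho> where \<rho>: "\<rho> \<in> \<rat>" "r - 3 * e < \<rho>" "\<rho> < r - 2 * e"
        using Rats_dense_in_real[of "r - 3 * e" "r - 2 * e"] e by auto
      obtain \<theta> where \<theta>: "\<theta> \<in> \<rat>" "1 - e < \<theta>" "\<theta> < 1"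
        using Rats_dense_in_real[of "1 - e" 1] e by auto
      have "cball d \<rho> \<subseteq> ball c r"
        using d(2) \<rho>(3) e(1) by (subst cball_subset_ball_iff) (auto simp: dist_commute)
      then have "(d, \<rho>, \<theta>) \<in> I"
        unfolding I_def using d \<rho> \<theta> e r(2) by auto
      moreover have "dist d c < 1 / Suc n" "\<bar>\<rho> - r\<bar> < 4 / Suc n" "\<bar>\<theta> - 1\<bar> < 1 / Suc n"
        using d(2) \<rho> \<theta> e(1) by (simp_all add: e_def dist_commute abs_less_iff)
      ultimately show ?thesis by blast
    qed
    then obtain d \<rho> \<theta> where A: "\<And>n. real (Suc n) > 4 / r \<Longrightarrow>
      (d n, \<rho> n, \<theta> n) \<in> I \<and> dist (d n) c < 1 / Suc n \<and> \<bar>\<rho> n - r\<bar> < 4 / Suc n \<and> \<bar>\<theta> n - 1\<bar> < 1 / Suc n"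
      by metis
    have ev: "\<forall>\<^sub>F n in sequentially. real (Suc n) > 4 / r"
      using filterlim_compose[OF filterlim_real_sequentially filterlim_Suc]
      by (simp add: filterlim_at_top_dense)
    have 0: "(\<lambda>n. K / real (Suc n)) \<longlonglongrightarrow> 0" for K
      using LIMSEQ_Suc[OF lim_const_over_n[of K]] .
    have "d \<longlonglongrightarrow> c"
      by (rule tendsto_dist_iff[THEN iffD2], rule tendsto_sandwich[OF _ _ tendsto_const 0[of 1]])
        (use ev A in \<open>auto elim!: eventually_mono intro: less_imp_le\<close>)
    moreover have "\<rho> \<longlonglongrightarrow> r"
      by (rule tendsto_dist_iff[THEN iffD2], rule tendsto_sandwich[OF _ _ tendsto_const 0[of 4]])
        (use ev A in \<open>auto simp: dist_real_def elim!: eventually_mono intro: less_imp_le\<close>)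
    moreover have "\<theta> \<longlonglongrightarrow> 1"
      by (rule tendsto_dist_iff[THEN iffD2], rule tendsto_sandwich[OF _ _ tendsto_const 0[of 1]])
        (use ev A in \<open>auto simp: dist_real_def elim!: eventually_mono intro: less_imp_le\<close>)
    ultimately have lim: "(\<lambda>n. \<theta> n * ((\<rho> n)\<^sup>2 - (norm (x - d n))\<^sup>2) / (2 * DIM('a)))
        \<longlonglongrightarrow> 1 * (r\<^sup>2 - (norm (x - c))\<^sup>2) / (2 * DIM('a))"
      by (intro tendsto_intros) auto
    have "\<forall>\<^sub>F n in sequentially. \<theta> n * ((\<rho> n)\<^sup>2 - (norm (x - d n))\<^sup>2) / (2 * DIM('a)) \<le> u x"
      using ev
    proof eventually_elim
      case (elim n)
      then have "(d n, \<rho> n, \<theta> n) \<in> I" using A by blast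
      with I show ?case by fastforce
    qed
    from tendsto_upperbound[OF lim this trivial_limit_sequentially]
    show "(r\<^sup>2 - (norm (x - c))\<^sup>2) / (2 * DIM('a)) \<le> u x" by simp
  qed
qed

section \<open>Integrals over strips along a line\<close>

text \<open>Lebesgue measure is determined by its values on boxes. The preimage of a box under
  \<open>f\<close> is its image under the inverse of \<open>f\<close>, again orthogonal and hence
  measure preserving.\<close>

lemma distr_lborel_orthogonal:
  fixes f :: "real^'n::{finite,wellorder} \<Rightarrow> real^'n::_"
  assumes f: "orthogonal_transformation f"
  shows "distr lborel borel f = lborel"
proof (rule lborel_eqI[symmetric])
  have cont: "continuous_on UNIV f"
    using orthogonal_transformation_linear[OF f] linear_continuous_on linear_conv_bounded_linear by blast
  then have meas: "f \<in> borel_measurable borel" by (rule borel_measurable_continuous_onI)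
  fix l u :: "real^'n::_" assume lu: "\<And>b. b \<in> Basis \<Longrightarrow> l \<bullet> b \<le> u \<bullet> b"
  have inv: "orthogonal_transformation (inv f)" using f by (rule orthogonal_transformation_inv)
  have eq: "f -` box l u = inv f ` box l u"
    using f by (simp add: bij_vimage_eq_inv_image orthogonal_transformation_bij)
  have lm: "f -` box l u \<in> lmeasurable"
    unfolding eq by (rule measurable_orthogonal_image[OF inv]) simp
  have borel: "f -` box l u \<in> sets borel"
    using measurable_sets[OF meas, of "box l u"] by simp
  have "emeasure (distr lborel borel f) (box l u) = emeasure lborel (f -` box l u)"
    using meas by (subst emeasure_distr) auto
  also have "\<dots> = emeasure lebesgue (f -` box l u)"
    using borel by simp
  also have "\<dots> = ennreal (measure lebesgue (f -` box l u))"
    using lm by (simp add: emeasure_eq_measure2)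
  also have "measure lebesgue (f -` box l u) = measure lebesgue (box l u)"
    unfolding eq by (rule measure_orthogonal_image[OF inv]) simp
  also have "\<dots> = (\<Prod>b\<in>Basis. (u - l) \<bullet> b)"
    using lu by (simp add: measure_lborel_box)
  finally show "emeasure (distr lborel borel f) (box l u) = (\<Prod>b\<in>Basis. (u - l) \<bullet> b)" .
qed simp

lemma orthogonal_transformation_frame:
  fixes e n :: "real^2"
  assumes "norm e = 1" "norm n = 1" "e \<bullet> n = 0"
  shows "orthogonal_transformation (\<lambda>y :: real^2. (y $ 1) *\<^sub>R e + (y $ 2) *\<^sub>R n)" (is "orthogonal_transformation ?A")
  unfolding orthogonal_transformation_def
proof (intro conjI allI)
  have *: "e \<bullet> e = 1" "n \<bullet> n = 1" "n \<bullet> e = 0"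
    using assms by (auto simp: norm_eq_1 inner_commute)
  show "linear ?A"
    by (intro linearI) (auto simp: algebra_simps)
  have "?A v \<bullet> ?A w = v $ 1 * w $ 1 + v $ 2 * w $ 2" for v w :: "real^2"
    using assms * by (simp add: inner_simps)
  then show "?A v \<bullet> ?A w = v \<bullet> w" for v w :: "real^2"
    by (simp add: inner_vec_def sum_2)
qed

lemma orthonormal_expansion:
  fixes e n w :: "real^2"
  assumes "norm e = 1" "norm n = 1" "e \<bullet> n = 0"
  shows "w = (w \<bullet> e) *\<^sub>R e + (w \<bullet> n) *\<^sub>R n"
proof -
  obtain y :: "real^2" where y: "w = (y $ 1) *\<^sub>R e + (y $ 2) *\<^sub>R n"
    using orthogonal_transformation_surj[OF orthogonal_transformation_frame[OF assms]] by blast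
  have "n \<bullet> e = 0" using assms(3) by (simp add: inner_commute)
  then have "w \<bullet> e = y $ 1" "w \<bullet> n = y $ 2"
    using assms by (simp_all add: y inner_simps norm_eq_1)
  with y show ?thesis by simp
qed

text \<open>The isometry sending the coordinate axes to \<open>e\<close> and \<open>n\<close> turns
  the integrand into a product over \<open>Basis\<close>; the shift by \<open>a\<close> is absorbed
  by translation invariance in each variable.\<close>

lemma nn_integral_orthonormal:
  fixes e n :: "real^2"
  assumes en: "norm e = 1" "norm n = 1" "e \<bullet> n = 0"
    and fg: "f \<in> borel_measurable borel" "g \<in> borel_measurable borel"
  shows "(\<integral>\<^sup>+x. f ((x - a) \<bullet> e) * g ((x - a) \<bullet> n) \<partial>lborel)
    = (\<integral>\<^sup>+s. f s \<partial>lborel) * (\<integral>\<^sup>+t. g t \<partial>lborel)"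
proof -
  define A where "A y = (y $ 1) *\<^sub>R e + (y $ 2) *\<^sub>R n" for y :: "real^2"
  have en': "e \<bullet> e = 1" "n \<bullet> n = 1" "n \<bullet> e = 0"
    using en by (auto simp: norm_eq_1 inner_commute)
  have A: "orthogonal_transformation A"
    unfolding A_def by (rule orthogonal_transformation_frame[OF en])
  have Ae: "A y \<bullet> e = y $ 1" "A y \<bullet> n = y $ 2" for y
    using en en' by (simp_all add: A_def inner_simps)
  have A_meas: "A \<in> borel_measurable borel"
    using orthogonal_transformation_linear[OF A] linear_continuous_on linear_conv_bounded_linear
      borel_measurable_continuous_onI by blast
  note [measurable] = fg
  have shift: "(\<integral>\<^sup>+s. h (s + c) \<partial>lborel) = (\<integral>\<^sup>+s. h s \<partial>lborel)"
    if "h \<in> borel_measurable borel" for h :: "real \<Rightarrow> ennreal" and c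
    using nn_integral_real_affine[OF that, of 1 c] by (simp add: add.commute)
  have Basis2: "(Basis :: (real^2) set) = {axis 1 1, axis 2 1}"
    by (auto simp: Basis_vec_def UNIV_2)
  have neq: "axis 1 1 \<noteq> (axis 2 1 :: real^2)" by (simp add: axis_eq_axis)
  define k where "k b = (if b = axis 1 1 then (\<lambda>s. f (s - a \<bullet> e)) else (\<lambda>t. g (t - a \<bullet> n)))" for b :: "real^2"
  have "(\<integral>\<^sup>+x. f ((x - a) \<bullet> e) * g ((x - a) \<bullet> n) \<partial>lborel)
      = (\<integral>\<^sup>+x. f ((x - a) \<bullet> e) * g ((x - a) \<bullet> n) \<partial>distr lborel borel A)"
    unfolding distr_lborel_orthogonal[OF A] ..
  also have "\<dots> = (\<integral>\<^sup>+y. f ((A y - a) \<bullet> e) * g ((A y - a) \<bullet> n) \<partial>lborel)"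
    using A_meas by (subst nn_integral_distr) auto
  also have "\<dots> = (\<integral>\<^sup>+y. (\<Prod>b\<in>Basis. k b (y \<bullet> b)) \<partial>lborel)"
    unfolding Basis2 using neq
    by (intro nn_integral_cong) (simp add: k_def inner_diff_left Ae inner_axis)
  also have "\<dots> = (\<Prod>b\<in>Basis. (\<integral>\<^sup>+s. k b s \<partial>lborel))"
    by (rule nn_integral_lborel_prod) (auto simp: k_def)
  also have "\<dots> = (\<integral>\<^sup>+s. f (s - a \<bullet> e) \<partial>lborel) * (\<integral>\<^sup>+t. g (t - a \<bullet> n) \<partial>lborel)"
    unfolding Basis2 using neq by (simp add: k_def)
  also have "\<dots> = (\<integral>\<^sup>+s. f s \<partial>lborel) * (\<integral>\<^sup>+t. g t \<partial>lborel)"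
    using shift[OF fg(1), of "- (a \<bullet> e)"] shift[OF fg(2), of "- (a \<bullet> n)"] by simp
  finally show ?thesis .
qed

section \<open>One-dimensional integrals of the negative power\<close>

lemma neg_power_measurable [measurable]: "(\<lambda>t. neg_power t \<beta>) \<in> borel_measurable borel"
  unfolding neg_power_def by measurable

lemma neg_power_antimono: "0 \<le> \<beta> \<Longrightarrow> s \<le> t \<Longrightarrow> neg_power t \<beta> \<le> neg_power s \<beta>"
  by (auto simp: neg_power_def intro!: ennreal_leI powr_mono2')

text \<open>Vanishing factors are covered too: a value of \<open>neg_power\<close> is never 0, so
  the value \<infinity> absorbs the other factor.\<close>

lemma neg_power_mult:
  assumes "0 \<le> s" "0 \<le> t" shows "neg_power (s * t) \<beta> = neg_power s \<beta> * neg_power t \<beta>"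
  using assms
  by (auto simp: neg_power_def zero_less_mult_iff powr_mult ennreal_mult ennreal_top_mult ennreal_mult_top)

lemma nn_integral_neg_power:
  assumes "\<beta> < 1" "0 \<le> l"
  shows "(\<integral>\<^sup>+t. neg_power t \<beta> * indicator {0..l} t \<partial>lborel) = ennreal (l powr (1 - \<beta>) / (1 - \<beta>))"
proof -
  have "(\<integral>\<^sup>+t. neg_power t \<beta> * indicator {0..l} t \<partial>lborel)
      = (\<integral>\<^sup>+t. ennreal (indicator {0..l} t * t powr - \<beta>) \<partial>lborel)"
  proof (rule nn_integral_cong_AE)
    show "AE t in lborel. neg_power t \<beta> * indicator {0..l} t = ennreal (indicator {0..l} t * t powr - \<beta>)"
      using AE_lborel_singleton[of "0::real"]
      by eventually_elim (auto simp: neg_power_def indicator_def)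
  qed
  also have "\<dots> = ennreal (l powr (- \<beta> + 1) / (- \<beta> + 1))"
    using assms by (intro nn_integral_has_integral_lebesgue has_integral_powr_from_0) auto
  finally show ?thesis by simp
qed

text \<open>The minimum equals one of its arguments, so its negative power is at most the sum of
  both. Reflecting t to l - t gives the two terms the same integral, hence the factor 2.\<close>

lemma nn_integral_neg_power_min:
  assumes "\<beta> < 1" "0 \<le> l"
  shows "(\<integral>\<^sup>+t. neg_power (min t (l - t)) \<beta> * indicator {0..l} t \<partial>lborel)
    \<le> ennreal (2 * (l powr (1 - \<beta>) / (1 - \<beta>)))"
proof -
  have "(\<integral>\<^sup>+t. neg_power (min t (l - t)) \<beta> * indicator {0..l} t \<partial>lborel)
    \<le> (\<integral>\<^sup>+t. neg_power t \<beta> * indicator {0..l} t + neg_power (l - t) \<beta> * indicator {0..l} (l - t) \<partial>lborel)"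
    by (intro nn_integral_mono) (auto simp: min_def indicator_def)
  also have "\<dots> = (\<integral>\<^sup>+t. neg_power t \<beta> * indicator {0..l} t \<partial>lborel)
      + (\<integral>\<^sup>+t. neg_power (l - t) \<beta> * indicator {0..l} (l - t) \<partial>lborel)"
    by (rule nn_integral_add) auto
  also have "(\<integral>\<^sup>+t. neg_power (l - t) \<beta> * indicator {0..l} (l - t) \<partial>lborel)
      = (\<integral>\<^sup>+t. neg_power t \<beta> * indicator {0..l} t \<partial>lborel)"
    using nn_integral_real_affine[of "\<lambda>t. neg_power t \<beta> * indicator {0..l} t" "- 1" l] by simp
  also have "(\<integral>\<^sup>+t. neg_power t \<beta> * indicator {0..l} t \<partial>lborel) + (\<integral>\<^sup>+t. neg_power t \<beta> * indicator {0..l} t \<partial>lborel)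
    = ennreal (2 * (l powr (1 - \<beta>) / (1 - \<beta>)))"
    unfolding nn_integral_neg_power[OF assms] using assms
    by (subst ennreal_plus[symmetric]) auto
  finally show ?thesis .
qed

section \<open>Sides of a convex polygon\<close>

text \<open>Coordinates adapted to a side of length \<open>l\<close>: \<open>a\<close> is an
  endpoint, \<open>e\<close> the direction and \<open>n\<close> the outer normal. The side is
  recorded twice: as a segment, to supply the coordinate s, and as the part of \<open>P\<close> on a
  supporting line, so that the line determines the side.\<close>

definition frame :: "(real^2) set \<Rightarrow> (real^2) set \<Rightarrow> real^2 \<Rightarrow> real^2 \<Rightarrow> real^2 \<Rightarrow> real \<Rightarrow> bool" where
  "frame P F a e n l \<longleftrightarrow> norm e = 1 \<and> norm n = 1 \<and> e \<bullet> n = 0 \<and> l > 0 \<and>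
     F = {a + s *\<^sub>R e |s. 0 \<le> s \<and> s \<le> l} \<and>
     (\<forall>x\<in>P. (x - a) \<bullet> n \<le> 0) \<and> F = {x\<in>P. (x - a) \<bullet> n = 0}"

text \<open>Faces of a polyhedron are exposed, which yields the supporting line and the normal. As
  \<open>P\<close> has interior points, the facet has dimension 1, and a compact convex collinear
  set is a segment.\<close>

lemma facet_frame:
  assumes P: "polytope P" "interior P \<noteq> {}" and F: "F facet_of P"
  shows "\<exists>a e n l. frame P F a e n l"
proof -
  have face: "F face_of P" "F \<noteq> {}" and dim: "aff_dim F = 1"
    using F P aff_dim_nonempty_interior[of P] by (auto simp: facet_of_def)
  have "F \<noteq> P" using F facet_of_irrefl by blast
  have "F exposed_face_of P"
    using exposed_face_of_polyhedron[OF polytope_imp_polyhedron[OF P(1)]] face(1) by blast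
  then obtain \<nu> b where \<nu>: "P \<subseteq> {x. \<nu> \<bullet> x \<le> b}" "F = P \<inter> {x. \<nu> \<bullet> x = b}"
    unfolding exposed_face_of_def by blast
  have "\<nu> \<noteq> 0" using \<nu> \<open>F \<noteq> P\<close> \<open>F \<noteq> {}\<close> by auto
  have "polytope F" using P(1) face(1) face_of_polytope_polytope by blast
  then obtain p q where pq: "F = closed_segment p q"
    using compact_convex_collinear_segment[of F] face(2) dim polytope_imp_compact polytope_imp_convex
    by (metis collinear_aff_dim order_refl)
  have "p \<noteq> q" using pq dim by auto
  define n where "n = \<nu> /\<^sub>R norm \<nu>"
  define e where "e = (q - p) /\<^sub>R norm (q - p)"
  have n: "(x - p) \<bullet> n = (\<nu> \<bullet> x - b) / norm \<nu>" for x
    using \<nu>(2) pq ends_in_segment(1)[of p q]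
    by (auto simp: n_def inner_diff_left inner_commute divide_inverse algebra_simps)
  have "(q - p) \<bullet> n = 0"
    using n[of q] \<nu>(2) pq ends_in_segment(2)[of p q] by auto
  then have en: "e \<bullet> n = 0" by (simp add: e_def)
  have norms: "norm e = 1" "norm n = 1"
    using \<open>p \<noteq> q\<close> \<open>\<nu> \<noteq> 0\<close> by (auto simp: e_def n_def)
  have seg: "F = {p + s *\<^sub>R e |s. 0 \<le> s \<and> s \<le> norm (q - p)}"
  proof (intro set_eqI iffI)
    fix x assume "x \<in> F"
    then obtain t where t: "0 \<le> t" "t \<le> 1" "x = (1 - t) *\<^sub>R p + t *\<^sub>R q"
      by (auto simp: pq in_segment)
    then have "x = p + (t * norm (q - p)) *\<^sub>R e"
      using \<open>p \<noteq> q\<close> by (simp add: e_def algebra_simps)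
    moreover have "t * norm (q - p) \<le> norm (q - p)"
      using t by (simp add: mult_left_le_one_le)
    ultimately show "x \<in> {p + s *\<^sub>R e |s. 0 \<le> s \<and> s \<le> norm (q - p)}"
      using t by (auto intro!: exI[of _ "t * norm (q - p)"])
  next
    fix x assume "x \<in> {p + s *\<^sub>R e |s. 0 \<le> s \<and> s \<le> norm (q - p)}"
    then obtain s where s: "0 \<le> s" "s \<le> norm (q - p)" "x = p + s *\<^sub>R e" by auto
    define t where "t = s / norm (q - p)"
    have "x = (1 - t) *\<^sub>R p + t *\<^sub>R q"
      using s(3) by (simp add: t_def e_def divide_inverse algebra_simps)
    moreover have "0 \<le> t" "t \<le> 1" using s \<open>p \<noteq> q\<close> by (auto simp: t_def)
    ultimately show "x \<in> F" by (auto simp: pq in_segment)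
  qed
  have "\<forall>x\<in>P. (x - p) \<bullet> n \<le> 0"
    using \<nu>(1) by (auto simp: n divide_le_0_iff)
  moreover have "F = {x\<in>P. (x - p) \<bullet> n = 0}"
    using \<nu>(2) \<open>\<nu> \<noteq> 0\<close> by (auto simp: n)
  moreover have "norm (q - p) > 0" using \<open>p \<noteq> q\<close> by simp
  ultimately have "frame P F p e n (norm (q - p))"
    using norms en seg unfolding frame_def by blast
  then show ?thesis by blast
qed

section \<open>Discs touching a supporting line\<close>

text \<open>This is the equality case of Cauchy-Schwarz, in the form |w - r n|^2 \<le> r^2 - 2 r^2 +
  r^2 = 0. It yields the uniqueness of tangency points, centres and nearest points below.\<close>

lemma eq_scaleR_normalI:
  assumes "norm n = 1" "norm (w :: 'a::real_inner) \<le> r" "r \<le> w \<bullet> n"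
  shows "w = r *\<^sub>R n"
proof -
  have r: "0 \<le> r" using assms(2) norm_ge_zero order_trans by blast
  have "(norm (w - r *\<^sub>R n))\<^sup>2 = (norm w)\<^sup>2 - 2 * r * (w \<bullet> n) + r\<^sup>2"
    using assms(1) unfolding power2_norm_eq_inner
    by (simp add: inner_simps inner_commute norm_eq_1 power2_eq_square algebra_simps)
  also have "\<dots> \<le> r\<^sup>2 - 2 * r * r + r\<^sup>2"
    using assms r by (intro add_mono diff_mono mult_left_mono power_mono) auto
  also have "\<dots> = 0" by (simp add: power2_eq_square)
  finally show ?thesis by simp
qed

text \<open>The half-space keeps the centre at depth at least r, while y on its boundary is within r
  of the centre. Both the admissible disc and the largest disc about a point of \<Omega> are located
  this way.\<close>

lemma tangent_ball_center:
  fixes n :: "'a::euclidean_space"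
  assumes n: "norm n = 1" and ball: "ball c r \<subseteq> {x. (x - a) \<bullet> n \<le> 0}"
    and y: "(y - a) \<bullet> n = 0" "dist c y \<le> r"
  shows "c = y - r *\<^sub>R n"
proof -
  have "(c - a) \<bullet> n + t \<le> 0" if t: "0 < t" "t < r" for t
  proof -
    have "c + t *\<^sub>R n \<in> ball c r" using t n by (simp add: dist_norm)
    then have "(c + t *\<^sub>R n - a) \<bullet> n \<le> 0" using ball by auto
    then show ?thesis using n by (simp add: inner_simps norm_eq_1)
  qed
  then have "t \<le> - ((c - a) \<bullet> n)" if "0 < t" "t < r" for t
    using that by fastforce
  then have "r \<le> - ((c - a) \<bullet> n)" if "0 < r"
    using dense_le_bounded[OF that] by blast
  moreover have "(c - a) \<bullet> n = (c - y) \<bullet> n"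
    using y(1) by (simp add: inner_simps)
  moreover have "0 \<le> r" using y(2) zero_le_dist order_trans by blast
  ultimately have "r \<le> (y - c) \<bullet> n"
    using y(2) by (cases "r = 0") (auto simp: inner_simps)
  with eq_scaleR_normalI[OF n, of "y - c" r] y(2)
  have "y - c = r *\<^sub>R n" by (simp add: dist_norm norm_minus_commute)
  then show ?thesis by (simp add: algebra_simps)
qed

lemma ball_convex_combination:
  fixes z :: "'a::euclidean_space"
  assumes P: "convex P" "ball c R \<subseteq> P" "z \<in> P" and t: "0 < t" "t \<le> 1"
  shows "ball (t *\<^sub>R c + (1 - t) *\<^sub>R z) (t * R) \<subseteq> interior P"
proof (rule interior_maximal[OF _ open_ball], rule subsetI)
  fix w assume w: "w \<in> ball (t *\<^sub>R c + (1 - t) *\<^sub>R z) (t * R)"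
  define w' where "w' = (w - (1 - t) *\<^sub>R z) /\<^sub>R t"
  have "c - w' = (t *\<^sub>R c + (1 - t) *\<^sub>R z - w) /\<^sub>R t"
    using t by (simp add: w'_def algebra_simps)
  then have "norm (c - w') = norm (t *\<^sub>R c + (1 - t) *\<^sub>R z - w) / t"
    using t by (simp add: divide_inverse mult.commute)
  also have "\<dots> < R" using w t by (simp add: dist_norm divide_less_eq mult.commute)
  finally have "w' \<in> P" using P(2) by (auto simp: dist_norm)
  moreover have "w = t *\<^sub>R w' + (1 - t) *\<^sub>R z" using t by (simp add: w'_def)
  ultimately show "w \<in> P" using P(1,3) t by (simp add: convexD)
qed

text \<open>Homothety with centre \<open>z\<close> on the side slides the ball tangent at \<open>p\<close> along the side.\<close>

lemma tangent_ball_slide: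
  assumes P: "convex P" and F: "frame P F a e n l" and R: "ball (p - R *\<^sub>R n) R \<subseteq> P" "p \<in> F"
    and s: "0 < s" "s < l"
  defines "r \<equiv> R * (min s (l - s) / l)"
  shows "ball (a + s *\<^sub>R e - r *\<^sub>R n) r \<subseteq> interior P"
proof -
  have l: "l > 0" and F_eq: "F = {a + s *\<^sub>R e |s. 0 \<le> s \<and> s \<le> l}" and "F \<subseteq> P"
    using F by (auto simp: frame_def)
  obtain m where m: "p = a + m *\<^sub>R e" "0 \<le> m" "m \<le> l" using R(2) F_eq by auto
  define t where "t = min s (l - s) / l"
  have t: "0 < t" "t < 1" "t * l \<le> s" "t * l \<le> l - s"
    using s l by (auto simp: t_def min_def field_simps)
  \<comment> \<open>The centre of the homothety, at position \<open>k\<close>, solves t m + (1 - t)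
    k = s, so the tangency point moves to position s. The bounds t l \<le> s and t l \<le> l - s put
    \<open>k\<close> into [0, l] wherever \<open>m\<close> lies on the side.\<close>
  define k where "k = (s - t * m) / (1 - t)"
  have "t * m \<le> t * l" "t * (l - m) \<le> t * l" using t m by (auto intro: mult_left_mono)
  then have "0 \<le> s - t * m" "s - t * m \<le> l * (1 - t)"
    using t(3,4) by (auto simp: algebra_simps)
  then have "0 \<le> k" "k \<le> l" using t by (auto simp: k_def divide_le_eq)
  then have z: "a + k *\<^sub>R e \<in> P" using F_eq \<open>F \<subseteq> P\<close> by auto
  have "(1 - t) * k = s - t * m" using t by (simp add: k_def)
  then have "t *\<^sub>R (p - R *\<^sub>R n) + (1 - t) *\<^sub>R (a + k *\<^sub>R e) = a + s *\<^sub>R e - r *\<^sub>R n"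
    unfolding m(1) r_def t_def[symmetric] scaleR_add_right scaleR_diff_right scaleR_scaleR
    by (simp add: algebra_simps) (simp add: algebra_simps flip: scaleR_add_left)
  then show ?thesis
    using ball_convex_combination[OF P R(1) z t(1)] t(2) by (simp add: r_def t_def mult.commute)
qed

text \<open>The frontier of \<open>P\<close> is the union of its facets, so a nearest frontier point
  lies on some side. The open ball reaching up to it is connected and misses the frontier, hence
  stays in \<open>P\<close>.\<close>

lemma nearest_side_point:
  assumes P: "polytope P" "x \<in> interior P"
  obtains F y where "F facet_of P" "y \<in> F" "ball x (dist x y) \<subseteq> interior P" "0 < dist x y"
proof -
  have "bounded P" "closed P" using P(1) polytope_imp_bounded polytope_imp_closed by auto
  then have "frontier P \<noteq> {}"
    using P(2) frontier_not_empty[of P] interior_subset not_bounded_UNIV by blast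
  then obtain y where y: "y \<in> frontier P" "\<And>z. z \<in> frontier P \<Longrightarrow> dist x y \<le> dist x z"
    using distance_attains_inf[of "frontier P" x] by auto
  have "y \<noteq> x" using y(1) P(2) by (auto simp: frontier_def)
  have "ball x (dist x y) \<inter> frontier P = {}" using y(2) by fastforce
  moreover have "x \<in> ball x (dist x y) \<inter> P" using \<open>y \<noteq> x\<close> P(2) interior_subset by auto
  ultimately have "ball x (dist x y) \<subseteq> P"
    using connected_Int_frontier[OF connected_ball, of x "dist x y" P] by blast
  then have "ball x (dist x y) \<subseteq> interior P" by (simp add: interior_maximal)
  moreover have "y \<in> \<Union> {F. F facet_of P}"
    using y(1) rel_frontier_of_polyhedron[OF polytope_imp_polyhedron[OF P(1)]]
      rel_frontier_nonempty_interior[of P] P(2) by auto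
  ultimately show thesis using that \<open>y \<noteq> x\<close> by auto
qed

lemma frame_memD:
  assumes "frame P F a e n l" "y \<in> F"
  shows "y \<in> P" "(y - a) \<bullet> n = 0" "0 \<le> (y - a) \<bullet> e" "(y - a) \<bullet> e \<le> l" "y = a + ((y - a) \<bullet> e) *\<^sub>R e"
  using assms by (auto simp: frame_def norm_eq_1)

lemma facet_disjnt_interior:
  assumes "polytope P" "F facet_of P"
  shows "F \<inter> interior P = {}"
  using assms rel_frontier_of_polyhedron[OF polytope_imp_polyhedron[OF assms(1)]]
    rel_frontier_nonempty_interior[of P] unfolding frontier_def by blast

section \<open>Existence of an admissible radius\<close>

text \<open>A face meeting the open segment between the ends of \<open>F\<close> contains both ends,
  so \<open>G\<close> would contain \<open>F\<close>. Then \<open>F\<close> would be a proper face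
  of \<open>G\<close>, although both have the same dimension.\<close>

lemma midpoint_in_unique_facet:
  assumes P: "polytope P" "interior P \<noteq> {}" and F: "F facet_of P" "frame P F a e n l"
    and G: "G facet_of P" "G \<noteq> F"
  shows "a + (l / 2) *\<^sub>R e \<notin> G"
proof
  assume mid: "a + (l / 2) *\<^sub>R e \<in> G"
  have l: "l > 0" "e \<noteq> 0" using F(2) by (auto simp: frame_def)
  have ends: "a \<in> F" "a + l *\<^sub>R e \<in> F"
    using F(2) l(1) unfolding frame_def by (auto intro: exI[of _ 0] exI[of _ l])
  have faceF: "F face_of P" and faceG: "G face_of P" using F G by (auto simp: facet_of_def)
  have "a + (l / 2) *\<^sub>R e = midpoint a (a + l *\<^sub>R e)"
    by (simp add: midpoint_def vec_eq_iff field_simps)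
  moreover have "midpoint a (a + l *\<^sub>R e) \<in> open_segment a (a + l *\<^sub>R e)"
    using l by (simp add: midpoint_in_open_segment)
  ultimately have "a + (l / 2) *\<^sub>R e \<in> open_segment a (a + l *\<^sub>R e)" by simp
  then have ends': "a \<in> G" "a + l *\<^sub>R e \<in> G"
    using face_ofD[OF faceG _ _ _ mid] ends face_of_imp_subset[OF faceF] by blast+
  have "F \<subseteq> closed_segment a (a + l *\<^sub>R e)"
  proof
    fix y assume "y \<in> F"
    then obtain s where s: "0 \<le> s" "s \<le> l" "y = a + s *\<^sub>R e" using F(2) by (auto simp: frame_def)
    then have "y = (1 - s / l) *\<^sub>R a + (s / l) *\<^sub>R (a + l *\<^sub>R e)"
      using l by (simp add: algebra_simps)
    moreover have "0 \<le> s / l" "s / l \<le> 1" using s l by auto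
    ultimately show "y \<in> closed_segment a (a + l *\<^sub>R e)" by (auto simp: in_segment)
  qed
  then have "F \<subseteq> G"
    using closed_segment_subset[OF ends'] face_of_imp_convex[OF faceG] by blast
  then have "F face_of G" using face_of_subset[OF faceF _ face_of_imp_subset[OF faceG]] by blast
  then have "aff_dim F < aff_dim G"
    using face_of_aff_dim_lt[OF face_of_imp_convex[OF faceG]] G(2) by blast
  then show False using F(1) G(1) by (simp add: facet_of_def)
qed

text \<open>The disc touches \<open>F\<close> at its midpoint, around which a ball of radius d
  avoids the other sides. For r < d/2 the disc stays in that ball, and it lies strictly on the inner
  side of the line of \<open>F\<close>, so it misses the frontier; being connected, it lies in
  \<open>P\<close> once it contains one point of \<open>P\<close>.\<close>

lemma eventually_tangent_ball:
  assumes P: "polytope P" "interior P \<noteq> {}" and F: "F facet_of P"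
  shows "\<forall>\<^sub>F r in at_right 0. \<exists>c. ball c r \<subseteq> interior P \<and> tangent_to_side c r F"
proof -
  obtain a e n l where fr: "frame P F a e n l" using facet_frame[OF P F] by blast
  then have n: "norm n = 1" and F_eq: "F = {x\<in>P. (x - a) \<bullet> n = 0}" and l: "l > 0"
    by (auto simp: frame_def)
  obtain x0 where x0: "x0 \<in> interior P" using P(2) by blast
  then have "x0 \<in> P" "x0 \<notin> F" using interior_subset facet_disjnt_interior[OF P(1) F] by auto
  then have q: "(x0 - a) \<bullet> n < 0" using fr F_eq by (auto simp: frame_def order_less_le)
  define y where "y = a + (l / 2) *\<^sub>R e"
  have yF: "y \<in> F" using fr l unfolding frame_def y_def by (auto intro!: exI[of _ "l / 2"])
  have y: "y \<in> P" "(y - a) \<bullet> n = 0" using frame_memD[OF fr yF] by auto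
  define H where "H = \<Union> {G. G facet_of P \<and> G \<noteq> F}"
  have "closed H"
    unfolding H_def using finite_polytope_facets[OF P(1)] P(1)
    by (intro closed_Union) (auto intro!: polytope_imp_closed elim: finite_subset[rotated]
        intro: face_of_polytope_polytope facet_of_imp_face_of)
  moreover have "y \<notin> H" unfolding H_def y_def using midpoint_in_unique_facet[OF P F fr] by blast
  ultimately obtain d where d: "d > 0" "ball y d \<inter> H = {}"
    using openE[of "- H" y] by (metis Compl_iff disjoint_eq_subset_Compl open_Compl)
  have "\<exists>c. ball c r \<subseteq> interior P \<and> tangent_to_side c r F" if r: "0 < r" "r < d / 2" for r
  proof -
    define c where "c = y - r *\<^sub>R n"
    have dc: "dist c y = r" using n r by (simp add: c_def dist_norm)
    have ca: "(c - a) \<bullet> n = - r" using y(2) n by (simp add: c_def inner_simps norm_eq_1)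
    have "ball c r \<subseteq> ball y d"
    proof
      fix z assume "z \<in> ball c r"
      then show "z \<in> ball y d" using dc r dist_triangle[of y z c] by (simp add: dist_commute)
    qed
    moreover have "z \<notin> F" if "z \<in> ball c r" for z
    proof -
      have "(z - c) \<bullet> n \<le> norm (z - c) * norm n" by (rule norm_cauchy_schwarz)
      also have "\<dots> < r" using that n by (simp add: dist_norm norm_minus_commute)
      finally have "(z - a) \<bullet> n < 0" using ca by (simp add: inner_simps)
      then show ?thesis using F_eq by auto
    qed
    moreover have "frontier P \<subseteq> F \<union> H"
      using rel_frontier_of_polyhedron[OF polytope_imp_polyhedron[OF P(1)]]
        rel_frontier_nonempty_interior[OF P(2)] unfolding H_def by blast
    ultimately have nf: "ball c r \<inter> frontier P = {}" using d(2) by blast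
    define D where "D = (norm (x0 - y))\<^sup>2"
    \<comment> \<open>That one point of \<open>P\<close> is sought on the way from the tangency
      point to \<open>x0\<close>. With q = (x0 - a) \<bullet> n < 0 one has |z - c|^2 = r^2 + t (t D
      - 2 r |q|), and this t keeps t D at most r |q|, which puts \<open>z\<close> inside the
      disc.\<close>
    define t where "t = min 1 (r * (- ((x0 - a) \<bullet> n)) / D)"
    have "x0 \<noteq> y" using q y by auto
    then have D: "D > 0" by (simp add: D_def)
    then have t: "0 < t" "t \<le> 1" using r q by (auto simp: t_def divide_simps zero_less_mult_iff mult_less_0_iff)
    have "t * D \<le> r * (- ((x0 - a) \<bullet> n))" using D by (simp add: t_def min_def field_simps)
    then have tD: "t * D < 2 * r * (- ((x0 - a) \<bullet> n))" using r q mult_pos_neg[of r "(x0 - a) \<bullet> n"] by simp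
    define z where "z = (1 - t) *\<^sub>R y + t *\<^sub>R x0"
    have "z \<in> P" unfolding z_def using polytope_imp_convex[OF P(1)] y(1) \<open>x0 \<in> P\<close> t by (simp add: convexD)
    have zc: "z - c = t *\<^sub>R (x0 - y) + r *\<^sub>R n" by (simp add: z_def c_def algebra_simps)
    have "(norm (t *\<^sub>R w + r *\<^sub>R n))\<^sup>2 = t * (t * (norm w)\<^sup>2) + 2 * t * r * (w \<bullet> n) + r\<^sup>2" for w
      using n unfolding power2_norm_eq_inner
      by (simp add: inner_simps inner_commute norm_eq_1 power2_eq_square algebra_simps)
    then have "(norm (z - c))\<^sup>2 = t * (t * D) + 2 * t * r * ((x0 - y) \<bullet> n) + r\<^sup>2"
      unfolding zc D_def .
    also have "(x0 - y) \<bullet> n = (x0 - a) \<bullet> n" using y(2) by (simp add: inner_simps)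
    also have "t * (t * D) + 2 * t * r * ((x0 - a) \<bullet> n) + r\<^sup>2 = t * (t * D - 2 * r * (- ((x0 - a) \<bullet> n))) + r\<^sup>2"
      by (simp add: algebra_simps)
    also have "\<dots> < r\<^sup>2" using tD t by (simp add: mult_pos_neg)
    finally have "z \<in> ball c r"
      using r by (simp add: dist_norm norm_minus_commute power_less_imp_less_base)
    then have "ball c r \<subseteq> P"
      using connected_Int_frontier[OF connected_ball, of c r P] nf \<open>z \<in> P\<close> by blast
    then have "ball c r \<subseteq> interior P" by (simp add: interior_maximal)
    moreover have "cball c r \<inter> affine hull F = {y}"
    proof (intro equalityI subsetI)
      fix z assume z: "z \<in> cball c r \<inter> affine hull F"
      have "affine hull F \<subseteq> {z. n \<bullet> z = n \<bullet> a}"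
        using F_eq by (intro hull_minimal affine_hyperplane) (auto simp: inner_simps inner_commute)
      then have "(z - a) \<bullet> n = 0" using z by (auto simp: inner_simps inner_commute)
      then have "(z - c) \<bullet> n = r" using ca by (simp add: inner_simps)
      with eq_scaleR_normalI[OF n, of "z - c" r] z have "z - c = r *\<^sub>R n"
        by (simp add: dist_norm norm_minus_commute)
      then show "z \<in> {y}" by (simp add: c_def)
    qed (use dc yF hull_subset in \<open>auto simp: dist_commute intro: hull_inc\<close>)
    ultimately show ?thesis using yF unfolding tangent_to_side_def by blast
  qed
  then show ?thesis
    using d(1) by (auto simp: eventually_at_right[of 0 "d"] intro!: exI[of _ "d / 2"])
qed

text \<open>There are finitely many sides, so one small radius serves all of them. It guarantees
  that the supremum defining \<open>max_admissible_radius\<close> is taken over a non-empty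
  set.\<close>

lemma admissible_radius_exists:
  assumes P: "polytope P" "interior P \<noteq> {}"
  shows "\<exists>R. admissible_radius (interior P) R"
proof -
  have cl: "closure (interior P) = P"
    using convex_closure_interior[OF polytope_imp_convex[OF P(1)] P(2)] polytope_imp_closed[OF P(1)] by simp
  have "\<forall>\<^sub>F r in at_right 0. 0 < r \<and> (\<forall>F\<in>sides (interior P). \<exists>c. ball c r \<subseteq> interior P \<and> tangent_to_side c r F)"
    using eventually_tangent_ball[OF P] finite_polytope_facets[OF P(1)] unfolding sides_def cl
    by (intro eventually_conj eventually_at_right_less eventually_ball_finite) auto
  then show ?thesis
    unfolding admissible_radius_def using eventually_happens'[OF trivial_limit_at_right_real] by blast
qed

section \<open>The perimeter\<close>

text \<open>For x in two strips, each supporting line makes the corresponding foot a nearest point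
  of \<open>P\<close>, so the two heights agree. Then feet and normals coincide, and the common
  supporting line forces equal sides. Each strip has area l D and the disc has area 4 \<pi> D^2;
  dividing by D gives the constant.\<close>

lemma sum_side_lengths_le:
  assumes P: "bounded P" "x0 \<in> P" "0 < diameter P" and S: "finite S"
    and fr: "\<And>F. F \<in> S \<Longrightarrow> frame P F (a F) (e F) (n F) (l F)"
  shows "(\<Sum>F\<in>S. l F) \<le> 4 * pi * diameter P"
proof -
  define D where "D = diameter P"
  have D: "D > 0" using P(3) by (simp add: D_def)
  define strip where "strip F = {x. (x - a F) \<bullet> e F \<in> {0..l F} \<and> (x - a F) \<bullet> n F \<in> {0<..<D}}" for F
  have meas: "strip F \<in> sets lborel" for F
    unfolding strip_def by measurable
  have em: "emeasure lborel (strip F) = ennreal (l F * D)" if "F \<in> S" for F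
  proof -
    have f: "norm (e F) = 1" "norm (n F) = 1" "e F \<bullet> n F = 0" "0 < l F"
      using fr[OF that] by (auto simp: frame_def)
    have "emeasure lborel (strip F) = (\<integral>\<^sup>+x. indicator (strip F) x \<partial>lborel)"
      using meas by simp
    also have "\<dots> = (\<integral>\<^sup>+x. indicator {0..l F} ((x - a F) \<bullet> e F) * indicator {0<..<D} ((x - a F) \<bullet> n F) \<partial>lborel)"
      by (intro nn_integral_cong) (auto simp: strip_def indicator_def)
    also have "\<dots> = (\<integral>\<^sup>+s. indicator {0..l F} s \<partial>lborel) * (\<integral>\<^sup>+t. indicator {0<..<D} t \<partial>lborel)"
      by (rule nn_integral_orthonormal[OF f(1-3)]) auto
    also have "\<dots> = ennreal (l F * D)"
      using D f(4) by (simp add: ennreal_mult)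
    finally show ?thesis .
  qed
  have foot: "\<exists>y\<in>F. x = y + ((x - a F) \<bullet> n F) *\<^sub>R n F \<and> 0 < (x - a F) \<bullet> n F \<and> (x - a F) \<bullet> n F < D"
    if "F \<in> S" "x \<in> strip F" for F x
  proof -
    have f: "norm (e F) = 1" "norm (n F) = 1" "e F \<bullet> n F = 0"
      and F_eq: "F = {a F + s *\<^sub>R e F |s. 0 \<le> s \<and> s \<le> l F}"
      using fr[OF that(1)] by (auto simp: frame_def)
    have "a F + ((x - a F) \<bullet> e F) *\<^sub>R e F \<in> F"
      by (subst F_eq) (use that(2) in \<open>auto simp: strip_def\<close>)
    moreover have "x = a F + ((x - a F) \<bullet> e F) *\<^sub>R e F + ((x - a F) \<bullet> n F) *\<^sub>R n F"
      using orthonormal_expansion[OF f, of "x - a F"] by (simp add: algebra_simps)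
    ultimately show ?thesis using that(2) by (auto simp: strip_def)
  qed
  have "disjoint_family_on strip S"
  proof (unfold disjoint_family_on_def, intro ballI impI)
    fix F G assume FG: "F \<in> S" "G \<in> S" "F \<noteq> G"
    show "strip F \<inter> strip G = {}"
    proof (rule ccontr)
      assume "strip F \<inter> strip G \<noteq> {}"
      then obtain x where x: "x \<in> strip F" "x \<in> strip G" by blast
      define h where "h F = (x - a F) \<bullet> n F" for F
      obtain y where y: "y \<in> F" "x = y + h F *\<^sub>R n F" "0 < h F" using foot[OF FG(1) x(1)] by (auto simp: h_def)
      obtain z where z: "z \<in> G" "x = z + h G *\<^sub>R n G" "0 < h G" using foot[OF FG(2) x(2)] by (auto simp: h_def)
      have far: "h K \<le> (x - w) \<bullet> n K" "norm (n K) = 1" if "K \<in> S" "w \<in> P" for K w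
        using fr[OF that(1)] that(2) by (auto simp: frame_def h_def inner_simps)
      have xy: "x - y = h F *\<^sub>R n F" using y(2) by simp
      moreover have "x - z = h G *\<^sub>R n G" using z(2) by simp
      ultimately have norms: "norm (x - y) = h F" "norm (x - z) = h G"
        using y(3) z(3) far(2)[OF FG(1) P(2)] far(2)[OF FG(2) P(2)] by simp_all
      have mem: "y \<in> P" "z \<in> P" using frame_memD(1)[OF fr] FG y z by auto
      have "h K \<le> norm (x - w)" if "K \<in> S" "w \<in> P" for K w
        using far[OF that] norm_cauchy_schwarz[of "x - w" "n K"] by simp
      from this[OF FG(1) mem(2)] this[OF FG(2) mem(1)] have hh: "h F = h G" using norms by simp
      have "x - z = h F *\<^sub>R n F"
        using eq_scaleR_normalI[OF far(2)[OF FG(1) mem(2)], of "x - z" "h F"] far(1)[OF FG(1) mem(2)] norms hh by simp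
      with xy have "x - z = x - y" by simp
      then have yz: "y = z" by simp
      then have nn: "n F = n G" using y(2) z(2,3) hh by simp
      have "(w - a F) \<bullet> n F = (w - a G) \<bullet> n G" for w
        using frame_memD(2)[OF fr[OF FG(1)] y(1)] frame_memD(2)[OF fr[OF FG(2)] z(1)] yz nn by (simp add: inner_simps)
      then have "F = G" using fr[OF FG(1)] fr[OF FG(2)] unfolding frame_def by auto
      with FG show False by simp
    qed
  qed
  then have "(\<Sum>F\<in>S. emeasure lborel (strip F)) = emeasure lborel (\<Union>F\<in>S. strip F)"
    using meas S by (intro sum_emeasure) auto
  also have "\<dots> \<le> emeasure lborel (ball x0 (2 * D))"
  proof (rule emeasure_mono)
    show "(\<Union>F\<in>S. strip F) \<subseteq> ball x0 (2 * D)"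
    proof (rule UN_least, rule subsetI)
      fix F x assume F: "F \<in> S" "x \<in> strip F"
      obtain y where y: "y \<in> F" "x = y + ((x - a F) \<bullet> n F) *\<^sub>R n F" "0 < (x - a F) \<bullet> n F" "(x - a F) \<bullet> n F < D"
        using foot[OF F] by blast
      have "norm (x - y) = (x - a F) \<bullet> n F"
        using arg_cong[OF y(2), of "\<lambda>x. norm (x - y)"] y(3) fr[OF F(1)] by (simp add: frame_def)
      then have "dist y x < D" using y(4) by (simp add: dist_norm norm_minus_commute)
      moreover have "dist x0 y \<le> D"
        using diameter_bounded_bound[OF P(1,2)] frame_memD(1)[OF fr[OF F(1)] y(1)] by (simp add: D_def)
      ultimately show "x \<in> ball x0 (2 * D)" using dist_triangle[of x0 x y] by simp
    qed
  qed simp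
  also have "\<dots> = ennreal (pi * (2 * D)\<^sup>2)"
    using D by (simp add: emeasure_ball unit_ball_vol_2)
  finally have "(\<Sum>F\<in>S. ennreal (l F * D)) \<le> ennreal (pi * (2 * D)\<^sup>2)"
    using em by simp
  moreover have "0 \<le> l F * D" if "F \<in> S" for F using fr[OF that] D by (simp add: frame_def)
  ultimately have "(\<Sum>F\<in>S. l F * D) \<le> pi * (2 * D)\<^sup>2"
    by (subst (asm) sum_ennreal) (auto simp: ennreal_le_iff)
  then have "(\<Sum>F\<in>S. l F) * D \<le> (4 * pi * D) * D"
    unfolding sum_distrib_right by (simp add: power2_eq_square mult_ac)
  then show ?thesis using D by (simp add: D_def)
qed

section \<open>The integral of the negative power\<close>

text \<open>The disc about x touches the line of the side at y, so x = y - h n. Hence x and y share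
  the coordinate s, and the slid disc tangent at y has its centre on the same normal. The 4 in the
  hypothesis on \<open>v\<close> is twice the dimension.\<close>

lemma torsion_ge_near_side:
  assumes P: "convex P" and fr: "frame P F a e n l"
    and R: "0 < R" "ball (p - R *\<^sub>R n) R \<subseteq> P" "p \<in> F"
    and T: "\<And>c r. 0 < r \<Longrightarrow> ball c r \<subseteq> interior P \<Longrightarrow> (r\<^sup>2 - (norm (x - c))\<^sup>2) / 4 \<le> v"
    and y: "y \<in> F" "ball x (dist x y) \<subseteq> interior P" "0 < dist x y"
  shows "(x - a) \<bullet> e \<in> {0..l}" "(a - x) \<bullet> n = dist x y"
    "dist x y * (R / (4 * l) * min ((x - a) \<bullet> e) (l - (x - a) \<bullet> e)) \<le> v"
proof -
  define h s where "h = dist x y" and "s = (x - a) \<bullet> e"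
  have f: "norm e = 1" "norm n = 1" "e \<bullet> n = 0" "0 < l" "P \<subseteq> {x. (x - a) \<bullet> n \<le> 0}"
    using fr by (auto simp: frame_def)
  have h: "0 < h" using y(3) by (simp add: h_def)
  have "ball x h \<subseteq> {x. (x - a) \<bullet> n \<le> 0}"
    using y(2) interior_subset f(5) by (force simp: h_def)
  from tangent_ball_center[OF f(2) this frame_memD(2)[OF fr y(1)]]
  have x: "x = y - h *\<^sub>R n" by (simp add: h_def)
  have "n \<bullet> e = 0" using f(3) by (simp add: inner_commute)
  then have s_eq: "s = (y - a) \<bullet> e" by (simp add: s_def x inner_simps)
  with frame_memD[OF fr y(1)] have s: "0 \<le> s" "s \<le> l" and y_eq: "y = a + s *\<^sub>R e" by auto
  show "(x - a) \<bullet> e \<in> {0..l}" using s by (simp add: s_def)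
  show "(a - x) \<bullet> n = dist x y"
    using frame_memD(2)[OF fr y(1)] f(2) unfolding h_def[symmetric]
    by (simp add: x inner_simps norm_eq_1)
  have hv: "h\<^sup>2 / 4 \<le> v" using T[OF h, of x] y(2) by (simp add: h_def)
  have "h * (R / (4 * l) * min s (l - s)) \<le> v"
  proof (cases "0 < s \<and> s < l")
    \<comment> \<open>At an endpoint of the side no disc can be slid, but the claimed bound is then
      0.\<close>
    case False
    then have "min s (l - s) = 0" using s by auto
    moreover have "0 \<le> v" using hv zero_le_power2[of h] by linarith
    ultimately show ?thesis by simp
  next
    case True
    define r where "r = R * (min s (l - s) / l)"
    have r: "0 < r" using True R(1) f(4) by (simp add: r_def)
    have "ball (y - r *\<^sub>R n) r \<subseteq> interior P"
      using tangent_ball_slide[OF P fr R(2,3)] True by (simp add: y_eq r_def)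
    \<comment> \<open>\<open>x\<close> and the centre of the slid disc are at distance |r - h| on
      one normal, and r^2 - (r - h)^2 = h (2 r - h).\<close>
    from T[OF r this] have "(r\<^sup>2 - (r - h)\<^sup>2) / 4 \<le> v"
      using f(2) by (simp add: x algebra_simps flip: scaleR_diff_left)
    then have hrv: "h * (2 * r - h) / 4 \<le> v" by (simp add: power2_eq_square algebra_simps)
    \<comment> \<open>For h \<le> r the slid disc suffices, as h r \<le> h (2 r - h); for h > r the
      disc about x does, as h r \<le> h^2.\<close>
    have "h * r / 4 \<le> v"
    proof (cases "h \<le> r")
      case True
      then have "h * r \<le> h * (2 * r - h)" using h by (intro mult_left_mono) auto
      with hrv show ?thesis by linarith
    next
      case False
      then have "h * r \<le> h\<^sup>2" using h by (simp add: power2_eq_square)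
      with hv show ?thesis by linarith
    qed
    moreover have "h * (R / (4 * l) * min s (l - s)) = h * r / 4"
      by (simp add: r_def)
    ultimately show ?thesis by (simp only:)
  qed
  then show "dist x y * (R / (4 * l) * min ((x - a) \<bullet> e) (l - (x - a) \<bullet> e)) \<le> v"
    by (simp add: h_def s_def)
qed

text \<open>The constant factor contributes 4^\<beta> R^(-\<beta>) l^\<beta>, the integral along the
  side at most 2 l^(1-\<beta>)/(1-\<beta>), and the one across it D^(1-\<beta>)/(1-\<beta>). The two
  powers of l combine to l itself.\<close>

lemma nn_integral_side_strip:
  fixes e n :: "real^2"
  assumes en: "norm e = 1" "norm n = 1" "e \<bullet> n = 0" and l: "0 < l" and R: "0 < R" and D: "0 \<le> D"
    and \<beta>: "\<beta> < 1"
  shows "(\<integral>\<^sup>+x. neg_power (R / (4 * l)) \<beta> * (neg_power (min ((x - a) \<bullet> e) (l - (x - a) \<bullet> e)) \<beta>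
        * indicator {0..l} ((x - a) \<bullet> e)) * (neg_power (- ((x - a) \<bullet> n)) \<beta> * indicator {0..D} (- ((x - a) \<bullet> n))) \<partial>lborel)
    \<le> ennreal (2 * 4 powr \<beta> / (1 - \<beta>)\<^sup>2 * R powr - \<beta> * D powr (1 - \<beta>) * l)"
    (is "?I \<le> _")
proof -
  define q where "q = (1 - \<beta>)"
  have q: "q > 0" using \<beta> by (simp add: q_def)
  let ?f = "\<lambda>s. neg_power (min s (l - s)) \<beta> * indicator {0..l} s"
  let ?g = "\<lambda>t. neg_power t \<beta> * indicator {0..D} t"
  have "?I = (\<integral>\<^sup>+s. neg_power (R / (4 * l)) \<beta> * ?f s \<partial>lborel) * (\<integral>\<^sup>+t. ?g (- t) \<partial>lborel)"
    by (rule nn_integral_orthonormal[OF en]) auto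
  moreover have "(\<integral>\<^sup>+t. ?g (- t) \<partial>lborel) = ennreal (D powr q / q)"
    using nn_integral_real_affine[of ?g "- 1" 0] nn_integral_neg_power[OF \<beta> D] by (simp add: q_def)
  moreover have "(\<integral>\<^sup>+s. neg_power (R / (4 * l)) \<beta> * ?f s \<partial>lborel)
      \<le> ennreal ((R / (4 * l)) powr - \<beta>) * ennreal (2 * (l powr q / q))"
  proof -
    have "(\<integral>\<^sup>+s. neg_power (R / (4 * l)) \<beta> * ?f s \<partial>lborel) = neg_power (R / (4 * l)) \<beta> * (\<integral>\<^sup>+s. ?f s \<partial>lborel)"
      by (rule nn_integral_cmult) auto
    moreover have "neg_power (R / (4 * l)) \<beta> = ennreal ((R / (4 * l)) powr - \<beta>)"
      using R l by (simp add: neg_power_def)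
    ultimately show ?thesis
      using nn_integral_neg_power_min[OF \<beta>, of l] l by (simp only:) (intro mult_left_mono, auto simp: q_def)
  qed
  ultimately have "?I \<le> ennreal ((R / (4 * l)) powr - \<beta>) * ennreal (2 * (l powr q / q)) * ennreal (D powr q / q)"
    by (simp only: mult_right_mono zero_le)
  also have "\<dots> = ennreal ((R / (4 * l)) powr - \<beta> * (2 * (l powr q / q)) * (D powr q / q))"
    using less_imp_le[OF q]
    by (simp only: ennreal_mult'[symmetric] powr_ge_zero mult_nonneg_nonneg divide_nonneg_nonneg zero_le_numeral)
  also have "(R / (4 * l)) powr - \<beta> * (2 * (l powr q / q)) * (D powr q / q)
    = 2 * 4 powr \<beta> / q\<^sup>2 * R powr - \<beta> * D powr q * l"
  proof -
    have "(R / (4 * l)) powr - \<beta> = 4 powr \<beta> * R powr - \<beta> * l powr \<beta>"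
      using R l by (simp add: powr_divide powr_mult powr_minus_divide)
    then have "(R / (4 * l)) powr - \<beta> * (2 * (l powr q / q)) * (D powr q / q)
        = 2 * 4 powr \<beta> / q\<^sup>2 * R powr - \<beta> * D powr q * (l powr \<beta> * l powr q)"
      by (simp add: power2_eq_square)
    also have "l powr \<beta> * l powr q = l"
      using l by (simp add: q_def flip: powr_add)
    finally show ?thesis .
  qed
  finally show ?thesis by (simp only: q_def)
qed

lemma neg_power_integral_le:
  assumes P: "polytope P" "interior P \<noteq> {}" and R: "admissible_radius (interior P) R"
    and u: "u \<in> W012 (interior P)" "weak_laplacian (interior P) u (\<lambda>_. -1)"
    and \<beta>: "0 < \<beta>" "\<beta> < 1"
  shows "(\<integral>\<^sup>+x. neg_power (u x) \<beta> \<partial>lebesgue_on (interior P))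
    \<le> ennreal (8 * pi * 4 powr \<beta> / (1 - \<beta>)\<^sup>2 * R powr - \<beta> * diameter P powr (2 - \<beta>))"
proof -
  define D where "D = diameter P"
  have bdd: "bounded P" and conv: "convex P"
    using P(1) by (auto simp: polytope_imp_bounded polytope_imp_convex)
  have "P \<noteq> {}" using P(2) interior_subset by blast
  have R0: "0 < R" using R by (simp add: admissible_radius_def)
  define S where "S = {F. F facet_of P}"
  have fin: "finite S" unfolding S_def by (rule finite_polytope_facets[OF P(1)])
  have cl: "closure (interior P) = P"
    using convex_closure_interior[OF conv P(2)] polytope_imp_closed[OF P(1)] by simp
  have "\<forall>F\<in>S. \<exists>a e n l. frame P F a e n l" using facet_frame[OF P] by (simp add: S_def)
  then obtain a e n l where fr: "\<And>F. F \<in> S \<Longrightarrow> frame P F (a F) (e F) (n F) (l F)"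
    by metis
  \<comment> \<open>The tangency point is required on the side itself; this is what lets the
    homothety slide the disc along \<open>F\<close>.\<close>
  have tangent: "\<exists>p\<in>F. ball (p - R *\<^sub>R n F) R \<subseteq> P" if F: "F \<in> S" for F
  proof -
    have "F \<in> sides (interior P)" using F by (simp add: sides_def S_def cl)
    then obtain c p where c: "ball c R \<subseteq> interior P" and p: "p \<in> F" "cball c R \<inter> affine hull F = {p}"
      using R unfolding admissible_radius_def tangent_to_side_def by blast
    have c': "ball c R \<subseteq> P" using c interior_subset by blast
    then have "ball c R \<subseteq> {x. (x - a F) \<bullet> n F \<le> 0}" using fr[OF F] by (auto simp: frame_def)
    moreover have "dist c p \<le> R" using p(2) by auto
    ultimately have "c = p - R *\<^sub>R n F"
      using tangent_ball_center frame_memD(2)[OF fr[OF F] p(1)] fr[OF F] unfolding frame_def by blast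
    with c' p(1) show ?thesis by auto
  qed
  \<comment> \<open>This majorant lives on the inner strip of \<open>F\<close>. Summing it over all
    sides avoids cutting \<Omega> into the regions where a given side is nearest; the extra terms
    are non-negative.\<close>
  define G where "G F x = neg_power (R / (4 * l F)) \<beta>
      * (neg_power (min ((x - a F) \<bullet> e F) (l F - (x - a F) \<bullet> e F)) \<beta> * indicator {0..l F} ((x - a F) \<bullet> e F))
      * (neg_power (- ((x - a F) \<bullet> n F)) \<beta> * indicator {0..D} (- ((x - a F) \<bullet> n F)))" for F and x :: "real^2"
  have G_meas [measurable]: "G F \<in> borel_measurable borel" for F
    unfolding G_def by measurable
  have \<Omega>: "open (interior P)" "bounded (interior P)"
    using bdd bounded_subset interior_subset by blast+
  have "AE x in lebesgue_on (interior P). neg_power (u x) \<beta> \<le> (\<Sum>F\<in>S. G F x)"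
    using torsion_ge_ball[OF \<Omega> u]
  proof (rule AE_mp, intro AE_I2 impI)
    fix x assume "x \<in> space (lebesgue_on (interior P))"
      and T: "\<forall>c r. 0 < r \<longrightarrow> ball c r \<subseteq> interior P \<longrightarrow> (r\<^sup>2 - (norm (x - c))\<^sup>2) / (2 * DIM(real^2)) \<le> u x"
    then have x: "x \<in> interior P" by (simp add: space_restrict_space)
    obtain F y where F: "F facet_of P" "y \<in> F" "ball x (dist x y) \<subseteq> interior P" "0 < dist x y"
      using nearest_side_point[OF P(1) x] by blast
    then have FS: "F \<in> S" by (simp add: S_def)
    obtain p where p: "p \<in> F" "ball (p - R *\<^sub>R n F) R \<subseteq> P" using tangent[OF FS] by blast
    have T': "(r\<^sup>2 - (norm (x - c))\<^sup>2) / 4 \<le> u x" if "0 < r" "ball c r \<subseteq> interior P" for c r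
      using T that by simp
    note side = torsion_ge_near_side[OF conv fr[OF FS] R0 p(2,1) T' F(2,3,4)]
    let ?s = "(x - a F) \<bullet> e F"
    have h: "- ((x - a F) \<bullet> n F) = dist x y" using side(2) by (simp add: inner_simps)
    have "dist x y \<le> D"
      unfolding D_def using diameter_bounded_bound[OF bdd] x interior_subset frame_memD(1)[OF fr[OF FS] F(2)] by blast
    then have ind: "indicator {0..l F} ?s = (1::ennreal)" "indicator {0..D} (dist x y) = (1::ennreal)"
      using side(1) by auto
    have "0 < l F" using fr[OF FS] by (simp add: frame_def)
    have "neg_power (u x) \<beta> \<le> neg_power (dist x y * (R / (4 * l F) * min ?s (l F - ?s))) \<beta>"
      using \<beta>(1) side(3) by (intro neg_power_antimono) auto
    also have "\<dots> = neg_power (dist x y) \<beta> * (neg_power (R / (4 * l F)) \<beta> * neg_power (min ?s (l F - ?s)) \<beta>)"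
      using \<open>0 < l F\<close> R0 side(1) by (subst neg_power_mult, simp, simp, subst neg_power_mult) auto
    also have "\<dots> = G F x"
      unfolding G_def h ind by (simp add: mult_ac)
    also have "\<dots> \<le> (\<Sum>F\<in>S. G F x)" using FS fin by (intro member_le_sum) auto
    finally show "neg_power (u x) \<beta> \<le> (\<Sum>F\<in>S. G F x)" .
  qed
  then have "(\<integral>\<^sup>+x. neg_power (u x) \<beta> \<partial>lebesgue_on (interior P))
      \<le> (\<integral>\<^sup>+x. (\<Sum>F\<in>S. G F x) \<partial>lebesgue_on (interior P))"
    by (rule nn_integral_mono_AE)
  also have "\<dots> = (\<integral>\<^sup>+x. (\<Sum>F\<in>S. G F x) * indicator (interior P) x \<partial>lebesgue)"
    by (rule nn_integral_restrict_space) simp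
  also have "\<dots> \<le> (\<integral>\<^sup>+x. (\<Sum>F\<in>S. G F x) \<partial>lebesgue)"
    by (intro nn_integral_mono) (auto simp: indicator_def)
  also have "\<dots> = (\<integral>\<^sup>+x. (\<Sum>F\<in>S. G F x) \<partial>lborel)"
    by (rule nn_integral_completion)
  also have "\<dots> = (\<Sum>F\<in>S. \<integral>\<^sup>+x. G F x \<partial>lborel)"
    by (rule nn_integral_sum) simp
  also have "\<dots> \<le> (\<Sum>F\<in>S. ennreal (2 * 4 powr \<beta> / (1 - \<beta>)\<^sup>2 * R powr - \<beta> * D powr (1 - \<beta>) * l F))"
  proof (rule sum_mono)
    fix F assume "F \<in> S"
    from fr[OF this] show "(\<integral>\<^sup>+x. G F x \<partial>lborel)
      \<le> ennreal (2 * 4 powr \<beta> / (1 - \<beta>)\<^sup>2 * R powr - \<beta> * D powr (1 - \<beta>) * l F)"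
      unfolding G_def frame_def
      by (intro nn_integral_side_strip) (use R0 \<beta> diameter_ge_0[OF bdd] in \<open>auto simp: D_def\<close>)
  qed
  also have "\<dots> = ennreal (2 * 4 powr \<beta> / (1 - \<beta>)\<^sup>2 * R powr - \<beta> * D powr (1 - \<beta>) * (\<Sum>F\<in>S. l F))"
    unfolding sum_distrib_left using fr
    by (intro sum_ennreal mult_nonneg_nonneg divide_nonneg_nonneg) (auto simp: frame_def less_imp_le)
  \<comment> \<open>The perimeter bound turns the sum into one more power of D: the exponent 1 -
    \<beta> becomes 2 - \<beta>, and 2 times 4 \<pi> gives 8 \<pi>.\<close>
  also have "\<dots> \<le> ennreal (2 * 4 powr \<beta> / (1 - \<beta>)\<^sup>2 * R powr - \<beta> * D powr (1 - \<beta>) * (4 * pi * D))"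
  proof (intro ennreal_leI mult_left_mono)
    obtain x where "x \<in> interior P" using P(2) by blast
    then obtain d where "d > 0" "ball x d \<subseteq> P" using mem_interior by blast
    then have "2 * d \<le> D"
      unfolding D_def using diameter_subset[OF _ bdd, of "ball x d"] by simp
    then have "0 < diameter P" using \<open>d > 0\<close> by (simp add: D_def)
    then show "(\<Sum>F\<in>S. l F) \<le> 4 * pi * D"
      unfolding D_def using sum_side_lengths_le[OF bdd _ _ fin fr] \<open>P \<noteq> {}\<close> by blast
  qed simp
  also have "2 * 4 powr \<beta> / (1 - \<beta>)\<^sup>2 * R powr - \<beta> * D powr (1 - \<beta>) * (4 * pi * D)
      = 8 * pi * 4 powr \<beta> / (1 - \<beta>)\<^sup>2 * R powr - \<beta> * (D powr (1 - \<beta>) * D)"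
    by simp
  also have "D powr (1 - \<beta>) * D = D powr (2 - \<beta>)"
    using powr_mult_base[OF diameter_ge_0[OF bdd], of "1 - \<beta>"] by (simp add: D_def mult.commute)
  finally show ?thesis by (simp only: D_def)
qed

section \<open>Diameter, area and eccentricity\<close>

text \<open>A disc containing \<Omega> has radius at least half the diameter, and a disc contained
  in \<Omega> has radius at most sqrt(|\<Omega>|/\<pi>) by its area. The quotient of the extremal
  radii is the eccentricity, and squaring half the diameter produces the 4.\<close>

lemma diameter_sq_le_ecc_area:
  fixes \<Omega> :: "(real^2) set"
  assumes \<Omega>: "open \<Omega>" "bounded \<Omega>" "\<Omega> \<noteq> {}"
  shows "(diameter \<Omega>)\<^sup>2 \<le> 4 * (ecc \<Omega>)\<^sup>2 / pi * measure lebesgue \<Omega>"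
proof -
  define A where "A = measure lebesgue \<Omega>"
  define X where "X = {R1. R1 > 0 \<and> (\<exists>x. \<Omega> \<subseteq> ball x R1)}"
  define Y where "Y = {R2. R2 > 0 \<and> (\<exists>x. ball x R2 \<subseteq> \<Omega>)}"
  have "X \<noteq> {}" using bounded_subset_ballD[OF \<Omega>(2)] unfolding X_def by blast
  moreover have "diameter \<Omega> / 2 \<le> r" if "r \<in> X" for r
    using that diameter_subset[of \<Omega> "ball x r" for x] by (fastforce simp: X_def)
  ultimately have InfX: "diameter \<Omega> / 2 \<le> Inf X" by (intro cInf_greatest)
  have Y_le: "r \<le> sqrt (A / pi)" if r: "r \<in> Y" for r
  proof -
    obtain x where x: "0 < r" "ball x r \<subseteq> \<Omega>" using r by (auto simp: Y_def)
    then have "measure lebesgue (ball x r) \<le> A"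
      unfolding A_def using lmeasurable_open[OF \<Omega>(2,1)] by (intro measure_mono_fmeasurable) auto
    moreover have "measure lebesgue (ball x r) = pi * r\<^sup>2"
      using x by (simp add: content_ball unit_ball_vol_2)
    ultimately show ?thesis using x by (intro real_le_rsqrt) (simp add: field_simps)
  qed
  \<comment> \<open>One contained disc and the area bound make the supremum positive and finite, so
    the division in \<open>ecc\<close> is genuine.\<close>
  obtain r where r: "r \<in> Y" using \<Omega>(1,3) unfolding open_contains_ball Y_def by blast
  have "r \<le> Sup Y" using r Y_le by (intro cSup_upper bdd_aboveI[of Y "sqrt (A / pi)"]) auto
  then have SupY: "0 < Sup Y" using r by (auto simp: Y_def)
  have "Sup Y \<le> sqrt (A / pi)" using r Y_le by (intro cSup_least) auto
  have d0: "0 \<le> diameter \<Omega>" by (rule diameter_ge_0[OF \<Omega>(2)])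
  have ecc: "ecc \<Omega> = Inf X / Sup Y" by (simp add: ecc_def X_def Y_def)
  then have e0: "0 \<le> ecc \<Omega>" using InfX d0 SupY by simp
  have "diameter \<Omega> / 2 \<le> ecc \<Omega> * Sup Y" using InfX SupY by (simp add: ecc)
  also have "\<dots> \<le> ecc \<Omega> * sqrt (A / pi)"
    by (rule mult_left_mono) fact+
  finally have "(diameter \<Omega> / 2)\<^sup>2 \<le> (ecc \<Omega> * sqrt (A / pi))\<^sup>2"
    using d0 by (intro power_mono) auto
  moreover have "0 \<le> A" by (simp add: A_def)
  ultimately show ?thesis by (simp add: power_mult_distrib power_divide A_def field_simps)
qed

theorem theorem4p7:
  shows "\<exists>(m :: real \<Rightarrow> real) (C :: real \<Rightarrow> real \<Rightarrow> real).
    (\<forall>e. m e > 0) \<and>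
    (\<forall>(\<Omega> :: (real^2) set) (u :: real^2 \<Rightarrow> real) \<beta>.
       convex_polygon \<Omega> \<longrightarrow> u \<in> W012 \<Omega> \<longrightarrow> weak_laplacian \<Omega> u (\<lambda>_. -1) \<longrightarrow>
       0 < \<beta> \<longrightarrow> \<beta> < 1 \<longrightarrow>
       (\<integral>\<^sup>+x. neg_power (u x) \<beta> \<partial>lebesgue_on \<Omega>)
         \<le> ennreal (C (ecc \<Omega>) \<beta>
              * (diameter \<Omega> / max_admissible_radius \<Omega>) powr (m (ecc \<Omega>) * \<beta> + 2)
              * measure lebesgue \<Omega> powr (1 - \<beta>)))"
proof -
  \<comment> \<open>8^\<beta> is the 4^\<beta> of the side estimate times 2^\<beta> for using a
    radius above half of the supremum. The second factor of \<open>C\<close> is the constant in D^2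
    \<le> (4 e^2/\<pi>) |\<Omega>|, raised to 1 - \<beta>.\<close>
  define K where "K \<beta> = 8 * pi * 8 powr \<beta> / (1 - \<beta>)\<^sup>2" for \<beta> :: real
  define C where "C e \<beta> = K \<beta> * (4 * e\<^sup>2 / pi) powr (1 - \<beta>)" for e \<beta> :: real
  have "(\<integral>\<^sup>+x. neg_power (u x) \<beta> \<partial>lebesgue_on \<Omega>)
      \<le> ennreal (C (ecc \<Omega>) \<beta> * (diameter \<Omega> / max_admissible_radius \<Omega>) powr (1 * \<beta> + 2)
          * measure lebesgue \<Omega> powr (1 - \<beta>))"
    if poly: "convex_polygon \<Omega>" and u: "u \<in> W012 \<Omega>" "weak_laplacian \<Omega> u (\<lambda>_. -1)"
      and \<beta>: "0 < \<beta>" "\<beta> < 1" for \<Omega> :: "(real^2) set" and u \<beta>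
  proof -
    obtain P where P: "polytope P" "interior P \<noteq> {}" and \<Omega>_eq: "\<Omega> = interior P"
      using poly unfolding convex_polygon_def by blast
    have \<Omega>: "open \<Omega>" "bounded \<Omega>" "\<Omega> \<noteq> {}"
      using P polytope_imp_bounded[OF P(1)] bounded_subset[OF _ interior_subset] unfolding \<Omega>_eq by auto
    have cl: "closure \<Omega> = P"
      unfolding \<Omega>_eq using convex_closure_interior[OF polytope_imp_convex[OF P(1)] P(2)] polytope_imp_closed[OF P(1)]
      by simp
    define D where "D = diameter \<Omega>"
    have D_eq: "diameter P = D" using diameter_closure[OF \<Omega>(2)] by (simp add: cl D_def)
    define Adm where "Adm = {R. admissible_radius \<Omega> R}"
    have ne: "Adm \<noteq> {}" unfolding Adm_def \<Omega>_eq using admissible_radius_exists[OF P] by blast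
    \<comment> \<open>Without any side every positive radius would be admissible. One side provides
      a disc in \<Omega> and thereby the bound R \<le> D/2, which makes the supremum finite.\<close>
    have "sides \<Omega> \<noteq> {}"
    proof -
      obtain x where "x \<in> interior P" using P(2) by blast
      with nearest_side_point[OF P(1)] show ?thesis unfolding sides_def cl by blast
    qed
    then have Adm: "0 < R" "2 * R \<le> D" if R: "R \<in> Adm" for R
    proof -
      show "0 < R" using R by (simp add: Adm_def admissible_radius_def)
      obtain F where "F \<in> sides \<Omega>" using \<open>sides \<Omega> \<noteq> {}\<close> by blast
      then obtain x where "ball x R \<subseteq> \<Omega>"
        using R unfolding Adm_def admissible_radius_def by blast
      from diameter_subset[OF this \<Omega>(2)] \<open>0 < R\<close> show "2 * R \<le> D" by (simp add: D_def)
    qed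
    define M where "M = max_admissible_radius \<Omega>"
    have M_eq: "M = Sup Adm" by (simp add: M_def max_admissible_radius_def Adm_def)
    obtain R0 where R0: "R0 \<in> Adm" using ne by blast
    have "bdd_above Adm" using Adm(2) by (intro bdd_aboveI[of _ "D / 2"]) force
    then have "R0 \<le> M" unfolding M_eq using R0 by (intro cSup_upper)
    then have M0: "0 < M" using Adm(1)[OF R0] by linarith
    have MD: "2 * M \<le> D"
    proof -
      have "M \<le> D / 2" unfolding M_eq using ne Adm(2) by (intro cSup_least) force+
      then show ?thesis by simp
    qed
    have "M / 2 < Sup Adm" using M0 M_eq by simp
    then obtain R where R: "R \<in> Adm" "M / 2 < R" using less_cSupE ne by metis
    define q where "q = D / M"
    have q: "1 \<le> q" using M0 MD by (simp add: q_def)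
    have D0: "0 < D" using M0 MD by simp
    have "R powr - \<beta> \<le> (M / 2) powr - \<beta>"
      using R M0 \<beta> by (intro powr_mono2') auto
    also have "\<dots> = 2 powr \<beta> * M powr - \<beta>"
      using M0 by (simp add: powr_divide powr_minus_divide)
    finally have R_le: "R powr - \<beta> \<le> 2 powr \<beta> * M powr - \<beta>" .
    have 8: "8 powr \<beta> = 4 powr \<beta> * 2 powr \<beta>" by (simp flip: powr_mult)
    have "8 * pi * 4 powr \<beta> / (1 - \<beta>)\<^sup>2 * R powr - \<beta> * D powr (2 - \<beta>)
        \<le> 8 * pi * 4 powr \<beta> / (1 - \<beta>)\<^sup>2 * (2 powr \<beta> * M powr - \<beta>) * D powr (2 - \<beta>)"
      by (intro mult_right_mono mult_left_mono R_le) auto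
    also have "\<dots> = K \<beta> * (M powr - \<beta> * D powr (2 - \<beta>))"
      by (simp add: K_def 8)
    \<comment> \<open>D^(2-\<beta>) is split as D^\<beta> (D^2)^(1-\<beta>): the first power pairs
      with M to form the ratio q, the second is the one that the area controls.\<close>
    also have "M powr - \<beta> * D powr (2 - \<beta>) = q powr \<beta> * (D\<^sup>2) powr (1 - \<beta>)"
    proof -
      have "D powr (2 - \<beta>) = D powr \<beta> * D powr (2 * (1 - \<beta>))"
        by (simp add: algebra_simps flip: powr_add)
      also have "D powr (2 * (1 - \<beta>)) = (D\<^sup>2) powr (1 - \<beta>)"
        using D0 by (simp add: powr_powr flip: powr_numeral)
      finally show ?thesis using M0 D0 by (simp add: q_def powr_divide powr_minus_divide)
    qed
    \<comment> \<open>As q \<ge> 1, its exponent may be raised from \<beta> to m \<beta> + 2 with m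
      = 1.\<close>
    also have "K \<beta> * (q powr \<beta> * (D\<^sup>2) powr (1 - \<beta>))
        \<le> K \<beta> * (q powr (1 * \<beta> + 2) * (4 * (ecc \<Omega>)\<^sup>2 / pi * measure lebesgue \<Omega>) powr (1 - \<beta>))"
      using q \<beta> diameter_sq_le_ecc_area[OF \<Omega>]
      by (intro mult_left_mono mult_mono powr_mono powr_mono2) (auto simp: K_def D_def)
    also have "\<dots> = C (ecc \<Omega>) \<beta> * q powr (1 * \<beta> + 2) * measure lebesgue \<Omega> powr (1 - \<beta>)"
      unfolding C_def powr_mult[of "4 * (ecc \<Omega>)\<^sup>2 / pi" "measure lebesgue \<Omega>"] by simp
    finally have "8 * pi * 4 powr \<beta> / (1 - \<beta>)\<^sup>2 * R powr - \<beta> * D powr (2 - \<beta>)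
        \<le> C (ecc \<Omega>) \<beta> * q powr (1 * \<beta> + 2) * measure lebesgue \<Omega> powr (1 - \<beta>)" .
    moreover have "(\<integral>\<^sup>+x. neg_power (u x) \<beta> \<partial>lebesgue_on \<Omega>)
        \<le> ennreal (8 * pi * 4 powr \<beta> / (1 - \<beta>)\<^sup>2 * R powr - \<beta> * D powr (2 - \<beta>))"
      using neg_power_integral_le[OF P _ u[unfolded \<Omega>_eq] \<beta>] R(1) unfolding Adm_def \<Omega>_eq[symmetric] D_eq by blast
    ultimately show ?thesis
      unfolding q_def D_def M_def by (meson ennreal_leI order_trans)
  qed
  then show ?thesis
    by (intro exI[of _ "\<lambda>_. 1"] exI[of _ C]) simp
qed

end
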